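(* Let $\mathcal{M}=\{M^{(\lambda)}:\lambda>0\}$ and $\mathcal{N}=\{N^{(\lambda)}:\lambda>0\}$ be two quasianalytic weight matrices and put $n^{(\lambda)}_j:=N^{(\lambda)}_j/j!$. (Beurling case) If $\mathcal{O}^0\subsetneq\mathcal{E}^0_{(\mathcal{N})}$ in the sense that $\lim_{j\to+\infty}(n^{(\lambda)}_j)^{1/j}=+\infty$ for all $\lambda>0$, then $\mathcal{F}_{(\mathcal{N})}\setminus j^\infty(\mathcal{E}^0_{\{\mathcal{M}\}})$ is $\mathfrak{c}$-algebrable in $\mathcal{F}_{(\mathcal{N})}$ endowed with the Cauchy product (hence $\mathcal{F}_{(\mathcal{N})}\setminus j^\infty(\mathcal{E}^0_{(\mathcal{M})})$ too). (Roumieu case) If $\mathcal{O}^0\subsetneq\mathcal{E}^0_{\{\mathcal{N}\}}$ in the sense that $\sup_{j\in\mathbb{N}_{>0}}(n^{(\lambda)}_j)^{1/j}=+\infty$ for all $\lambda>0$, then $\mathcal{F}_{\{\mathcal{N}\}}\setminus j^\infty(\mathcal{E}^0_{\{\mathcal{M}\}})$ is $\mathfrak{c}$-algebrable in $\mathcal{F}_{\{\mathcal{N}\}}$ endowed with the Cauchy product (hence $\mathcal{F}_{\{\mathcal{N}\}}\setminus j^\infty(\mathcal{E}^0_{(\mathcal{M})})$ too).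
   Context: $\mathbb{N}=\{0,1,2,\dots\}$; $\mathfrak{c}$ is the cardinality of the continuum. For a sequence $M=(M_j)_{j\in\mathbb{N}}$ of positive reals put $m_j:=M_j/j!$. $M$ is a weight sequence if (I) $1=M_0\le M_1$; (II) $M$ is log-convex, i.e. $M_j^2\le M_{j-1}M_{j+1}$ for all $j\ge1$; (III) $\liminf_{j\to\infty}(m_j)^{1/j}>0$. $M$ is quasianalytic if $\sum_{j\ge1}M_{j-1}/M_j=+\infty$. A weight matrix is a family $\mathcal{M}=\{M^{(\lambda)}:\lambda>0\}$ of weight sequences indexed by the positive reals with $M^{(\lambda)}_j\le M^{(\kappa)}_j$ for all $j$ whenever $0<\lambda\le\kappa$; it is quasianalytic if every $M^{(\lambda)}$ is quasianalytic. Write $m^{(\lambda)}_j:=M^{(\lambda)}_j/j!$. For $U\subseteq\mathbb{R}$ nonempty open, $\mathcal{E}_{\{\mathcal{M}\}}(U)$, resp. $\mathcal{E}_{(\mathcal{M})}(U)$, is the set of complex-valued smooth $f$ on $U$ such that for every compact $K\subseteq U$ there exist $\lambda>0$ and $h>0$, resp. for every compact $K\subseteq U$, all $\lambda>0$ and all $h>0$, $\sup_{j\in\mathbb{N},x\in K}\frac{|f^{(j)}(x)|}{h^jM^{(\lambda)}_j}<+\infty$. $\mathcal{E}^0_{\{\mathcal{M}\}}$, $\mathcal{E}^0_{(\mathcal{M})}$ are the corresponding spaces of germs at $0$, i.e. $\varinjlim_k$ of the spaces on $(-\frac1k,\frac1k)$. $\mathcal{O}^0$ is the space of germs at $0$ of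 real analytic functions. $\mathcal{F}_{\{\mathcal{M}\}}$, resp. $\mathcal{F}_{(\mathcal{M})}$, is the space of formal power series $\mathbf{F}=\sum_{j\ge0}F_jx^j$ with complex coefficients such that for some $\lambda>0$ and some $h>0$, resp. for all $\lambda>0$ and all $h>0$, $\sup_{j}\frac{|F_j|}{h^jm^{(\lambda)}_j}<+\infty$. The Borel map is $j^\infty(f)=\sum_{j\ge0}\frac{f^{(j)}(0)}{j!}x^j$. The Cauchy product is $\mathbf{F}\ast\mathbf{G}=\sum_{j\ge0}\big(\sum_{r=0}^jF_rG_{j-r}\big)x^j$; under it $\mathcal{F}_{\{\mathcal{N}\}}$ and $\mathcal{F}_{(\mathcal{N})}$ are algebras. A subset $\mathcal{B}$ of an algebra $\mathcal{A}$ is $\kappa$-algebrable if there is a $\kappa$-generated subalgebra $\mathcal{C}$ of $\mathcal{A}$ (not required to contain a unit) with $\mathcal{C}\subseteq\mathcal{B}\cup\{0\}$; $\kappa$-generated means that $\mathcal{C}$ has a minimal system of generators of cardinality $\kappa$. *)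

theory Defs
  imports
    "HOL-Analysis.Analysis"
    "HOL-Library.Equipollence"
    "HOL-Computational_Algebra.Formal_Power_Series"
begin

subsection \<open>Weight sequences and weight matrices\<close>

definition div_fact :: "(nat \<Rightarrow> real) \<Rightarrow> nat \<Rightarrow> real" where
  "div_fact M j = M j / fact j"

definition weight_sequence :: "(nat \<Rightarrow> real) \<Rightarrow> bool" where
  "weight_sequence M \<longleftrightarrow>
     (\<forall>j. 0 < M j) \<and>
     M 0 = 1 \<and> 1 \<le> M 1 \<and>
     (\<forall>j\<ge>1. (M j)\<^sup>2 \<le> M (j - 1) * M (j + 1)) \<and>
     0 < liminf (\<lambda>j. ereal (root j (div_fact M j)))"

definition quasianalytic :: "(nat \<Rightarrow> real) \<Rightarrow> bool" where
  "quasianalytic M \<longleftrightarrow> filterlim (\<lambda>n. \<Sum>j=1..n. M (j - 1) / M j) at_top sequentially"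

text \<open>A weight matrix is a family indexed by the positive reals; values of \<open>\<M>\<close> at
  nonpositive indices are irrelevant everywhere below.\<close>

definition weight_matrix :: "(real \<Rightarrow> nat \<Rightarrow> real) \<Rightarrow> bool" where
  "weight_matrix \<M> \<longleftrightarrow>
     (\<forall>\<alpha>>0. weight_sequence (\<M> \<alpha>)) \<and>
     (\<forall>\<alpha> \<beta>. 0 < \<alpha> \<and> \<alpha> \<le> \<beta> \<longrightarrow> (\<forall>j. \<M> \<alpha> j \<le> \<M> \<beta> j))"

definition quasianalytic_matrix :: "(real \<Rightarrow> nat \<Rightarrow> real) \<Rightarrow> bool" where
  "quasianalytic_matrix \<M> \<longleftrightarrow> (\<forall>\<alpha>>0. quasianalytic (\<M> \<alpha>))"


subsection \<open>Ultradifferentiable functions\<close>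

text \<open>Functions on an open set \<open>U\<close> are represented by total functions whose values outside \<open>U\<close>
  are irrelevant: on \<open>U\<close>, the iterated derivative depends only on the restriction to \<open>U\<close>.\<close>

definition nderiv :: "nat \<Rightarrow> (real \<Rightarrow> complex) \<Rightarrow> real \<Rightarrow> complex" where
  "nderiv j = (\<lambda>f x. vector_derivative f (at x)) ^^ j"

definition smooth_on :: "real set \<Rightarrow> (real \<Rightarrow> complex) \<Rightarrow> bool" where
  "smooth_on U f \<longleftrightarrow> (\<forall>j. \<forall>x\<in>U. nderiv j f differentiable (at x))"

definition ultra_bounded ::
    "(nat \<Rightarrow> real) \<Rightarrow> real \<Rightarrow> real set \<Rightarrow> (real \<Rightarrow> complex) \<Rightarrow> bool" where
  "ultra_bounded M h K f \<longleftrightarrow>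
     bdd_above ((\<lambda>(j, x). cmod (nderiv j f x) / (h ^ j * M j)) ` (UNIV \<times> K))"

definition E_Roumieu :: "(real \<Rightarrow> nat \<Rightarrow> real) \<Rightarrow> real set \<Rightarrow> (real \<Rightarrow> complex) set" where
  "E_Roumieu \<M> U = {f. smooth_on U f \<and>
     (\<forall>K. compact K \<and> K \<subseteq> U \<longrightarrow> (\<exists>\<alpha>>0. \<exists>h>0. ultra_bounded (\<M> \<alpha>) h K f))}"

definition E_Beurling :: "(real \<Rightarrow> nat \<Rightarrow> real) \<Rightarrow> real set \<Rightarrow> (real \<Rightarrow> complex) set" where
  "E_Beurling \<M> U = {f. smooth_on U f \<and>
     (\<forall>K. compact K \<and> K \<subseteq> U \<longrightarrow> (\<forall>\<alpha>>0. \<forall>h>0. ultra_bounded (\<M> \<alpha>) h K f))}"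


subsection \<open>Germs at 0 and the Borel map\<close>

quotient_type germ0 = "real \<Rightarrow> complex" / "\<lambda>f g. eventually (\<lambda>x. f x = g x) (nhds 0)"
  morphisms rep_germ0 germ0_of
proof (rule equivpI)
  show "reflp (\<lambda>f g :: real \<Rightarrow> complex. eventually (\<lambda>x. f x = g x) (nhds 0))"
    by (simp add: reflp_def)
  show "symp (\<lambda>f g :: real \<Rightarrow> complex. eventually (\<lambda>x. f x = g x) (nhds 0))"
    by (simp add: symp_def eq_commute)
  show "transp (\<lambda>f g :: real \<Rightarrow> complex. eventually (\<lambda>x. f x = g x) (nhds 0))"
    by (auto simp: transp_def elim: eventually_elim2)
qed

text \<open>The direct limit of the spaces on \<open>(-1/k, 1/k)\<close> is the set of all germs represented by a
  member of one of these spaces.\<close>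

definition E0_Roumieu :: "(real \<Rightarrow> nat \<Rightarrow> real) \<Rightarrow> germ0 set" where
  "E0_Roumieu \<M> = (\<Union>k\<in>{1::nat..}. germ0_of ` E_Roumieu \<M> {- 1 / real k <..< 1 / real k})"

definition E0_Beurling :: "(real \<Rightarrow> nat \<Rightarrow> real) \<Rightarrow> germ0 set" where
  "E0_Beurling \<M> = (\<Union>k\<in>{1::nat..}. germ0_of ` E_Beurling \<M> {- 1 / real k <..< 1 / real k})"

lemma nderiv_eventually_eq:
  assumes "eventually (\<lambda>x. f x = g x) (nhds a)"
  shows "eventually (\<lambda>x. nderiv j f x = nderiv j g x) (nhds a)"
proof (induction j)
  case 0
  then show ?case using assms by (simp add: nderiv_def)
next
  case (Suc j)
  then have "eventually (\<lambda>y. eventually (\<lambda>x. nderiv j f x = nderiv j g x) (nhds y)) (nhds a)"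
    by (simp add: eventually_eventually)
  then show ?case
  proof eventually_elim
    case (elim y)
    then have "vector_derivative (nderiv j f) (at y) = vector_derivative (nderiv j g) (at y)"
      by (intro vector_derivative_cong_eq) auto
    then show ?case by (simp add: nderiv_def)
  qed
qed

lift_definition borel_map :: "germ0 \<Rightarrow> complex fps" is
  "\<lambda>f. Abs_fps (\<lambda>j. nderiv j f 0 / fact j)"
proof -
  fix f g :: "real \<Rightarrow> complex"
  assume "eventually (\<lambda>x. f x = g x) (nhds 0)"
  then have "nderiv j f 0 = nderiv j g 0" for j
    using nderiv_eventually_eq eventually_nhds_x_imp_x by blast
  then show "Abs_fps (\<lambda>j. nderiv j f 0 / fact j) = Abs_fps (\<lambda>j. nderiv j g 0 / fact j)"
    by simp
qed


subsection \<open>Spaces of formal power series\<close>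

definition fps_bounded :: "(nat \<Rightarrow> real) \<Rightarrow> real \<Rightarrow> complex fps \<Rightarrow> bool" where
  "fps_bounded M h F \<longleftrightarrow>
     bdd_above (range (\<lambda>j. cmod (fps_nth F j) / (h ^ j * div_fact M j)))"

definition F_Roumieu :: "(real \<Rightarrow> nat \<Rightarrow> real) \<Rightarrow> complex fps set" where
  "F_Roumieu \<M> = {F. \<exists>\<alpha>>0. \<exists>h>0. fps_bounded (\<M> \<alpha>) h F}"

definition F_Beurling :: "(real \<Rightarrow> nat \<Rightarrow> real) \<Rightarrow> complex fps set" where
  "F_Beurling \<M> = {F. \<forall>\<alpha>>0. \<forall>h>0. fps_bounded (\<M> \<alpha>) h F}"


subsection \<open>Algebrability\<close>

text \<open>The scalar action \<open>smul\<close> is a parameter, as there is no type class of complex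
  algebras. Subalgebras need not contain a unit.\<close>

definition subalgebra :: "('k \<Rightarrow> 'a \<Rightarrow> 'a) \<Rightarrow> 'a::ring set \<Rightarrow> bool" where
  "subalgebra smul C \<longleftrightarrow> 0 \<in> C \<and>
     (\<forall>f\<in>C. \<forall>g\<in>C. f + g \<in> C \<and> f * g \<in> C) \<and> (\<forall>c. \<forall>f\<in>C. smul c f \<in> C)"

definition minimal_generators :: "('k \<Rightarrow> 'a \<Rightarrow> 'a) \<Rightarrow> 'a::ring set \<Rightarrow> 'a set \<Rightarrow> bool" where
  "minimal_generators smul S C \<longleftrightarrow>
     subalgebra smul hull S = C \<and> (\<forall>T. T \<subset> S \<longrightarrow> subalgebra smul hull T \<noteq> C)"

text \<open>\<open>\<B>\<close> is \<open>\<kappa>\<close>-algebrable in the algebra \<open>\<A>\<close>, where the cardinal \<open>\<kappa>\<close> is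
  given by an arbitrary set \<open>K\<close> of that cardinality.\<close>

definition algebrable_in ::
    "('k \<Rightarrow> 'a \<Rightarrow> 'a) \<Rightarrow> 'a::ring set \<Rightarrow> 'b set \<Rightarrow> 'a set \<Rightarrow> bool" where
  "algebrable_in smul \<A> K \<B> \<longleftrightarrow>
     (\<exists>C. subalgebra smul C \<and> C \<subseteq> \<A> \<and> (\<exists>S. minimal_generators smul S C \<and> S \<approx> K) \<and>
          C \<subseteq> \<B> \<union> {0})"

text \<open>Multiplication of the type \<open>fps\<close> is the Cauchy product. The real line stands for
  the cardinal of the continuum.\<close>

definition continuum_algebrable_in :: "complex fps set \<Rightarrow> complex fps set \<Rightarrow> bool" where
  "continuum_algebrable_in \<A> \<B> \<longleftrightarrow>
     algebrable_in (\<lambda>c F. fps_const c * F) \<A> (UNIV :: real set) \<B>"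

end

(*
  Let F_t be the lacunary series with coefficient k^(2 p_k) exp(k^t) at x^(p_k), for 0 < t < 1,
  where (p_k) grows so fast that p_(k+1) > k p_k and more.  If P is a polynomial of degree d without
  constant term, then P(F_t1, ..., F_tr) has at x^(d p_k) exactly the value of the top homogeneous
  part of P at the k-th coefficients, and then no terms up to x^(p_(k+1)).  The exponentials exp(k^t)
  make one monomial dominate, so the coefficient at x^(d p_k) is at least a constant times
  k^(2 d p_k).

  On the other hand, let f belong to the quasianalytic class, with a gap in its Taylor series at 0
  after the degree n.  Bang's argument applied to f minus its Taylor polynomial T of degree n shows
  that this difference is at most 1 on [0, delta] once the gap is long enough, with a length that
  depends only on n, delta, the weight sequence and the constants in the bounds for f.  So T is
  bounded by C + 1 on [0, delta], and finite differences bound its leading coefficient by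
  (C + 1) (2 e / delta)^n.  Choosing the gap after k p_k according to the weight M^(k) and the
  constants h = C = 1/delta = k makes this apply to every f in the class for all large k, which
  contradicts the growth above.
*)
theory Submission
  imports Defs
begin

subsection \<open>Taylor bounds\<close>

lemma sum_exp_terms_le_exp:
  fixes x :: real
  assumes "0 \<le> x"
  shows "(\<Sum>i<n. x ^ i / fact i) \<le> exp x"
proof -
  have s: "(\<lambda>i. x ^ i / fact i) sums exp x"
    using exp_converges[of x] by (simp add: scaleR_conv_of_real divide_inverse mult.commute)
  show ?thesis
    using sum_le_suminf[OF sums_summable[OF s], of "{..<n}"] sums_unique[OF s] assms by simp
qed

text \<open>The quotient \<open>n ^ n / n!\<close> is a single term of the exponential series at
  \<open>n\<close>.\<close>

lemma power_self_le_exp_fact: "real n ^ n \<le> exp 1 ^ n * fact n"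
proof -
  have "real n ^ n / fact n \<le> (\<Sum>i<Suc n. real n ^ i / fact i)"
    by (rule member_le_sum) auto
  also have "\<dots> \<le> exp (real n)" by (rule sum_exp_terms_le_exp) simp
  also have "\<dots> = exp 1 ^ n" by (metis exp_of_nat_mult mult.right_neutral)
  finally show ?thesis by (simp add: field_simps)
qed

text \<open>The Lagrange form of the remainder fails for complex-valued functions. It is applied to
  the real part of \<open>u * g 0\<close>, where the unimodular factor \<open>u\<close> turns the
  value at the end point into its modulus (\<open>u\<close> is 0 if that value is 0); real parts at
  all other places are bounded by moduli.\<close>

lemma norm_taylor_le:
  fixes g :: "nat \<Rightarrow> real \<Rightarrow> complex"
  assumes der: "\<And>j y. x \<le> y \<Longrightarrow> y \<le> x + \<tau> \<Longrightarrow> (g j has_vector_derivative g (Suc j) y) (at y)"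
    and "0 \<le> \<tau>" and "0 < n"
    and bound: "\<And>y. x \<le> y \<Longrightarrow> y \<le> x + \<tau> \<Longrightarrow> cmod (g n y) \<le> B"
  shows "cmod (g 0 (x + \<tau>)) \<le> (\<Sum>i<n. cmod (g i x) * \<tau> ^ i / fact i) + B * \<tau> ^ n / fact n"
proof (cases "\<tau> = 0")
  case True
  have "(\<Sum>i<n. cmod (g i x) * 0 ^ i / fact i) = cmod (g 0 x)"
    using \<open>0 < n\<close> by (subst sum.remove[of _ 0]) (auto intro!: sum.neutral)
  then show ?thesis using True \<open>0 < n\<close> by (simp add: zero_power)
next
  case False
  then have "0 < \<tau>" using assms by simp
  define z where "z = g 0 (x + \<tau>)"
  define u where "u = cnj (sgn z)"
  have u: "cmod u \<le> 1" by (simp add: u_def norm_sgn)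
  have uz: "Re (u * z) = cmod z"
    by (cases "z = 0") (auto simp: u_def sgn_eq complex_norm_square[symmetric] mult.commute power2_eq_square
        simp flip: of_real_mult)
  have le: "\<bar>Re (u * w)\<bar> \<le> cmod w" for w
    using abs_Re_le_cmod[of "u * w"] mult_right_mono[OF u norm_ge_zero[of w]] by (simp add: norm_mult)
  define d where "d = (\<lambda>j y. Re (u * g j y))"
  have d: "DERIV (d j) y :> d (Suc j) y" if "x \<le> y" "y \<le> x + \<tau>" for j y
    unfolding d_def has_real_derivative_iff_has_vector_derivative
    using der[OF that] by (auto intro!: derivative_eq_intros simp: has_vector_derivative_def fun_eq_iff algebra_simps)
  obtain t where t: "x < t" "t < x + \<tau>"
    "d 0 (x + \<tau>) = (\<Sum>m<n. d m x / fact m * (x + \<tau> - x) ^ m) + d n t / fact n * (x + \<tau> - x) ^ n"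
    using Taylor_up[of n d "d 0" x "x + \<tau>" x] d \<open>0 < n\<close> \<open>0 < \<tau>\<close> by auto
  have "cmod z = (\<Sum>m<n. d m x / fact m * \<tau> ^ m) + d n t / fact n * \<tau> ^ n"
    using t uz by (simp add: d_def z_def)
  also have "\<dots> \<le> (\<Sum>i<n. cmod (g i x) * \<tau> ^ i / fact i) + B * \<tau> ^ n / fact n"
  proof (intro add_mono sum_mono)
    fix i
    have "d i x \<le> cmod (g i x)" using le[of "g i x"] by (simp add: d_def)
    then show "d i x / fact i * \<tau> ^ i \<le> cmod (g i x) * \<tau> ^ i / fact i"
      using \<open>0 < \<tau>\<close> by (simp add: divide_right_mono mult_right_mono)
  next
    have "d n t \<le> B" using le[of "g n t"] bound[of t] t by (simp add: d_def)
    then show "d n t / fact n * \<tau> ^ n \<le> B * \<tau> ^ n / fact n"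
      using \<open>0 < \<tau>\<close> by (simp add: divide_right_mono mult_right_mono)
  qed
  finally show ?thesis by (simp add: z_def)
qed

subsection \<open>Bang's decay estimate\<close>

text \<open>Log-convexity with the index shifted, which avoids subtraction. Positivity is included
  so that the ratios of consecutive entries make sense and increase.\<close>

definition log_convex :: "(nat \<Rightarrow> real) \<Rightarrow> bool" where
  "log_convex L \<longleftrightarrow> (\<forall>j. 0 < L j) \<and> (\<forall>j. (L (Suc j))\<^sup>2 \<le> L j * L (Suc (Suc j)))"

lemma log_convex_pos: "log_convex L \<Longrightarrow> 0 < L j"
  by (simp add: log_convex_def)

lemma log_convex_ratio_mono:
  assumes "log_convex L" "i \<le> j"
  shows "L (Suc i) / L i \<le> L (Suc j) / L j"
  using assms(2)
proof (induction j rule: dec_induct)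
  case (step j)
  have "L (Suc j) / L j \<le> L (Suc (Suc j)) / L (Suc j)"
    using assms(1) by (simp add: log_convex_def field_simps power2_eq_square)
  with step show ?case by simp
qed simp

text \<open>Each of the \<open>i\<close> ratios between \<open>j\<close> and \<open>j + i\<close> is
  at most the last one, \<open>L n / L (n - 1)\<close>.\<close>

lemma log_convex_growth:
  assumes "log_convex L" "0 < n" "j + i \<le> n"
  shows "L (j + i) \<le> L j * (L n / L (n - 1)) ^ i"
  using assms(3)
proof (induction i)
  case (Suc i)
  have p: "0 < L k" for k using assms(1) by (rule log_convex_pos)
  have "L (Suc (j + i)) / L (j + i) \<le> L (Suc (n - 1)) / L (n - 1)"
    using Suc.prems assms by (intro log_convex_ratio_mono) auto
  then have "L (Suc (j + i)) \<le> L (j + i) * (L n / L (n - 1))"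
    using p assms(2) by (simp add: pos_divide_le_eq mult.commute)
  also have "\<dots> \<le> (L j * (L n / L (n - 1)) ^ i) * (L n / L (n - 1))"
    using Suc p by (intro mult_right_mono) (auto simp: less_imp_le)
  finally show ?case by (simp add: mult_ac)
qed simp

text \<open>A move to the right by at most \<open>L (n - 1) / (exp 1 * L n)\<close> costs only one
  factor \<open>exp 1\<close>. For \<open>j < n\<close>, Taylor expansion of order
  \<open>n - j\<close> bounds the new value by the old bound times a partial sum of
  \<open>exp (exp 1 * r * \<tau>)\<close>, whose argument is at most 1. For \<open>j \<ge> n\<close>
  the claim is weaker than the global bound \<open>L j\<close>.\<close>

lemma bang_step:
  fixes g :: "nat \<Rightarrow> real \<Rightarrow> complex"
  assumes L: "log_convex L" and "0 < n"
    and der: "\<And>j y. x \<le> y \<Longrightarrow> y \<le> x + \<tau> \<Longrightarrow> (g j has_vector_derivative g (Suc j) y) (at y)"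
    and bound: "\<And>j y. x \<le> y \<Longrightarrow> y \<le> x + \<tau> \<Longrightarrow> cmod (g j y) \<le> L j"
    and start: "\<And>j. cmod (g j x) \<le> exp (real j - real n) * L j"
    and \<tau>: "0 \<le> \<tau>" "\<tau> \<le> L (n - 1) / (exp 1 * L n)"
  shows "cmod (g j (x + \<tau>)) \<le> exp (real j - real (n - 1)) * L j"
proof (cases "n \<le> j")
  case True
  have "cmod (g j (x + \<tau>)) \<le> 1 * L j" using bound \<tau> by simp
  also have "\<dots> \<le> exp (real j - real (n - 1)) * L j"
    using True log_convex_pos[OF L, of j] by (intro mult_right_mono) auto
  finally show ?thesis .
next
  case False
  define r where "r = L n / L (n - 1)"
  define c where "c = exp (real j - real n) * L j"
  have p: "0 < L k" for k using L by (rule log_convex_pos)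
  have r: "0 < r" and c: "0 < c" using p by (auto simp: r_def c_def)
  \<comment> \<open>Going up by \<open>i\<close> derivatives costs \<open>exp 1 ^ i\<close> from the
    starting bounds and at most \<open>r ^ i\<close> from \<open>L\<close>, which is what produces
    an exponential series.\<close>
  have grow: "exp (real (j + i) - real n) * L (j + i) * \<tau> ^ i / fact i \<le> c * ((exp 1 * r * \<tau>) ^ i / fact i)"
    if "j + i \<le> n" for i
  proof -
    have "exp (real (j + i) - real n) = exp (real j - real n) * exp 1 ^ i"
      by (simp flip: exp_of_nat_mult exp_add add: algebra_simps)
    then have "exp (real (j + i) - real n) * L (j + i) * \<tau> ^ i / fact i
        \<le> (exp (real j - real n) * exp 1 ^ i) * (L j * r ^ i) * \<tau> ^ i / fact i"
      using log_convex_growth[OF L \<open>0 < n\<close> that] \<tau>(1)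
      by (auto simp: r_def intro!: divide_right_mono mult_right_mono mult_left_mono)
    then show ?thesis by (simp add: c_def power_mult_distrib mult_ac)
  qed
  have "cmod (g (j + 0) (x + \<tau>)) \<le> (\<Sum>i<n - j. cmod (g (j + i) x) * \<tau> ^ i / fact i)
      + L n * \<tau> ^ (n - j) / fact (n - j)"
    using False bound[of _ n] \<tau>
    by (intro norm_taylor_le) (auto intro: der[of _ "j + _", simplified])
  also have "\<dots> \<le> (\<Sum>i<n - j. c * ((exp 1 * r * \<tau>) ^ i / fact i)) + c * ((exp 1 * r * \<tau>) ^ (n - j) / fact (n - j))"
  proof (intro add_mono sum_mono)
    fix i assume "i \<in> {..<n - j}"
    then have "j + i \<le> n" by simp
    have "cmod (g (j + i) x) * \<tau> ^ i / fact i \<le> exp (real (j + i) - real n) * L (j + i) * \<tau> ^ i / fact i"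
      using start[of "j + i"] \<tau>(1) by (intro divide_right_mono mult_right_mono) auto
    also note grow[OF \<open>j + i \<le> n\<close>]
    finally show "cmod (g (j + i) x) * \<tau> ^ i / fact i \<le> c * ((exp 1 * r * \<tau>) ^ i / fact i)" .
  next
    \<comment> \<open>The remainder fits as the next term of the series: for
      \<open>i = n - j\<close> the exponential weight in \<open>grow\<close> is 1.\<close>
    show "L n * \<tau> ^ (n - j) / fact (n - j) \<le> c * ((exp 1 * r * \<tau>) ^ (n - j) / fact (n - j))"
      using grow[of "n - j"] False by simp
  qed
  also have "\<dots> = c * (\<Sum>i<Suc (n - j). (exp 1 * r * \<tau>) ^ i / fact i)"
    by (simp add: sum_distrib_left distrib_left)
  also have "\<dots> \<le> c * exp (exp 1 * r * \<tau>)"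
    using c r \<tau> by (intro mult_left_mono sum_exp_terms_le_exp) auto
  also have "\<dots> \<le> c * exp 1"
    using c r \<tau>(2) p by (simp add: r_def field_simps)
  also have "\<dots> = exp (real j - real (n - 1)) * L j"
    using \<open>0 < n\<close> by (simp add: c_def of_nat_diff mult_ac flip: exp_add)
  finally show ?thesis by simp
qed

text \<open>At 0 the first \<open>q\<close> derivatives vanish and the others obey the trivial
  bound, so \<open>bang_step\<close> can start with \<open>n = q\<close>. Taking \<open>r\<close>
  steps, with \<open>n\<close> running down to \<open>q - r + 1\<close>, reaches every point up to
  the sum of the step lengths.\<close>

lemma bang_decay:
  fixes g :: "nat \<Rightarrow> real \<Rightarrow> complex"
  assumes L: "log_convex L"
    and der: "\<And>j x. 0 \<le> x \<Longrightarrow> x \<le> \<delta> \<Longrightarrow> (g j has_vector_derivative g (Suc j) x) (at x)"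
    and bound: "\<And>j x. 0 \<le> x \<Longrightarrow> x \<le> \<delta> \<Longrightarrow> cmod (g j x) \<le> L j"
    and flat: "\<And>j. j < q \<Longrightarrow> g j 0 = 0"
    and "r \<le> q" and "0 \<le> x" "x \<le> \<delta>"
    and "x \<le> (\<Sum>n = Suc (q - r)..q. L (n - 1) / (exp 1 * L n))"
  shows "cmod (g j x) \<le> exp (real j - real (q - r)) * L j"
  using assms(5-)
proof (induction r arbitrary: x j)
  case 0
  then have x: "x = 0" by simp
  show ?case
  proof (cases "j < q")
    case True
    then show ?thesis using flat[OF True] log_convex_pos[OF L, of j] by (simp add: x)
  next
    case False
    have "cmod (g j x) \<le> 1 * L j" using bound[of 0] 0 x by simp
    also have "\<dots> \<le> exp (real j - real (q - 0)) * L j"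
      using False log_convex_pos[OF L, of j] by (intro mult_right_mono) auto
    finally show ?thesis .
  qed
next
  case (Suc r)
  define n where "n = q - r"
  have n: "0 < n" "q - Suc r = n - 1" using Suc.prems by (auto simp: n_def)
  define t where "t = L (n - 1) / (exp 1 * L n)"
  have p: "0 < L k" for k using L by (rule log_convex_pos)
  have t: "0 < t" using p by (simp add: t_def)
  \<comment> \<open>The point from which the last step is made. It is cut off at 0, in which case
    that step is shorter than \<open>t\<close>.\<close>
  define y where "y = max 0 (x - t)"
  have S: "(\<Sum>i = n..q. L (i - 1) / (exp 1 * L i)) = t + (\<Sum>i = Suc n..q. L (i - 1) / (exp 1 * L i))"
    using n by (subst sum.atLeast_Suc_atMost) (auto simp: t_def n_def)
  have S0: "0 \<le> (\<Sum>i = Suc n..q. L (i - 1) / (exp 1 * L i))"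
    using p by (intro sum_nonneg) (auto simp: less_imp_le)
  have y: "0 \<le> y" "y \<le> \<delta>" "y \<le> x" "x - y \<le> t"
    using Suc.prems t by (auto simp: y_def)
  have ys: "y \<le> (\<Sum>i = Suc n..q. L (i - 1) / (exp 1 * L i))"
    using Suc.prems S S0 n by (auto simp: y_def)
  have "cmod (g j (y + (x - y))) \<le> exp (real j - real (n - 1)) * L j"
  proof (rule bang_step[OF L n(1)])
    show "cmod (g i y) \<le> exp (real i - real n) * L i" for i
      using Suc.IH[of y i] Suc.prems y ys by (simp add: n_def)
  qed (use y Suc.prems t_def der bound in auto)
  then show ?case using n by simp
qed

subsection \<open>Leading Taylor coefficients before a gap\<close>

text \<open>With \<open>n\<close>-th derivative constant, \<open>c * \<eta> ^ n\<close> is the \<open>n\<close>-th forward difference of \<open>D 0\<close>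
  with step \<open>\<eta>\<close>.\<close>

lemma constant_derivative_le:
  fixes D :: "nat \<Rightarrow> real \<Rightarrow> complex"
  assumes "\<And>i x. i < n \<Longrightarrow> (D i has_vector_derivative D (Suc i) x) (at x)"
    and "\<And>x. D n x = c"
    and "\<And>x. 0 \<le> x \<Longrightarrow> x \<le> real n * \<eta> \<Longrightarrow> cmod (D 0 x) \<le> B"
    and "0 \<le> \<eta>"
  shows "cmod c * \<eta> ^ n \<le> 2 ^ n * B"
  using assms
proof (induction n arbitrary: D c B)
  case 0
  then show ?case by (metis mult_1 mult_zero_left of_nat_0 order_refl power_0 mult.right_neutral)
next
  case (Suc n)
  define E where "E = (\<lambda>i x. D i (x + \<eta>) - D i x)"
  have "cmod (c * of_real \<eta>) * \<eta> ^ n \<le> 2 ^ n * (2 * B)"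
  proof (rule Suc.IH[of E])
    fix i x assume "i < n"
    have "((\<lambda>x. x + \<eta>) has_vector_derivative 1) (at x)"
      unfolding has_real_derivative_iff_has_vector_derivative[symmetric]
      by (auto intro!: derivative_eq_intros)
    then have "((\<lambda>x. D i (x + \<eta>)) has_vector_derivative D (Suc i) (x + \<eta>)) (at x)"
      using vector_diff_chain_at[of "\<lambda>x. x + \<eta>" 1 x "D i" "D (Suc i) (x + \<eta>)"] Suc.prems(1)[of i "x + \<eta>"] \<open>i < n\<close>
      by (simp add: o_def)
    then show "(E i has_vector_derivative E (Suc i) x) (at x)"
      using Suc.prems(1)[of i x] \<open>i < n\<close> unfolding E_def by (intro has_vector_derivative_diff) auto
  next
    have "((\<lambda>x. D n x - of_real x * c) has_vector_derivative 0) (at x)" for x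
      using Suc.prems(1)[of n x] Suc.prems(2)[of x]
      by (auto intro!: derivative_eq_intros)
    then obtain b where "D n x - of_real x * c = b" for x
      using has_vector_derivative_zero_constant[of UNIV "\<lambda>x. D n x - of_real x * c"] by auto
    then have "D n x = b + of_real x * c" for x by (simp add: algebra_simps)
    then show "E n x = c * of_real \<eta>" for x by (simp add: E_def algebra_simps)
  next
    fix x assume "0 \<le> x" "x \<le> real n * \<eta>"
    then have "cmod (D 0 (x + \<eta>)) \<le> B" "cmod (D 0 x) \<le> B"
      using Suc.prems(4) by (auto intro!: Suc.prems(3) simp: algebra_simps)
    then show "cmod (E 0 x) \<le> 2 * B"
      using norm_triangle_ineq4[of "D 0 (x + \<eta>)" "D 0 x"] by (simp add: E_def)
  qed (use Suc.prems in auto)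
  then show ?case using Suc.prems(4) by (simp add: norm_mult mult_ac)
qed

text \<open>Differentiation shifts the coefficients by one. With zeros above \<open>n\<close>, the
  summation range can stay the same for all derivatives, because the added top coefficient
  \<open>e (n + Suc j)\<close> is zero.\<close>

lemma taylor_polynomial_has_vector_derivative:
  fixes e :: "nat \<Rightarrow> complex"
  assumes "\<And>i. n < i \<Longrightarrow> e i = 0"
  shows "((\<lambda>x. \<Sum>i\<le>n. e (i + j) * of_real x ^ i / fact i) has_vector_derivative
    (\<Sum>i\<le>n. e (i + Suc j) * of_real x ^ i / fact i)) (at x)"
proof -
  have summand: "((\<lambda>x. e (i + j) * of_real x ^ i / fact i) has_vector_derivative
      e (i + j) * (of_nat i * of_real x ^ (i - 1)) / fact i) (at x)" for i
  proof -
    have "((\<lambda>z. e (i + j) * z ^ i / fact i) has_field_derivative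
        e (i + j) * (of_nat i * of_real x ^ (i - 1)) / fact i) (at (of_real x))"
      by (auto intro!: derivative_eq_intros)
    from has_vector_derivative_real_field[OF this] show ?thesis .
  qed
  have "(\<Sum>i\<le>n. e (i + j) * (of_nat i * of_real x ^ (i - 1)) / fact i)
      = (\<Sum>i<n. e (i + Suc j) * of_real x ^ i / fact i)"
    by (subst lessThan_Suc_atMost[symmetric], subst sum.lessThan_Suc_shift)
       (simp add: field_simps del: of_nat_Suc)
  also have "\<dots> = (\<Sum>i\<le>n. e (i + Suc j) * of_real x ^ i / fact i)"
    using assms[of "n + Suc j"] by (simp flip: lessThan_Suc_atMost)
  finally have "(\<Sum>i\<le>n. e (i + Suc j) * of_real x ^ i / fact i)
      = (\<Sum>i\<le>n. e (i + j) * (of_nat i * of_real x ^ (i - 1)) / fact i)" by simp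
  then show ?thesis
    by (simp only:) (intro has_vector_derivative_sum summand)
qed

text \<open>Subtracting the Taylor polynomial of degree \<open>n\<close> leaves a function that is
  flat of order \<open>q\<close> at 0, hence tiny on \<open>[0, \<delta>]\<close> by
  \<open>bang_decay\<close>; so the polynomial is bounded there, and so is its leading coefficient.
  The order of quantifiers matters: \<open>Q\<close> is fixed before \<open>f\<close>, so a gap can
  be planned for a whole class of functions.\<close>

lemma bang_gap:
  fixes C \<delta> :: real
  assumes L: "log_convex L" and L1: "L 0 = 1" "\<And>j. 1 \<le> L j"
    and quasi: "filterlim (\<lambda>n. \<Sum>j=1..n. L (j - 1) / L j) at_top sequentially"
    and "0 < C" and \<delta>: "0 < \<delta>" "\<delta> \<le> 1"
  shows "\<exists>Q. \<forall>q\<ge>Q. \<forall>f :: nat \<Rightarrow> real \<Rightarrow> complex.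
    (\<forall>j x. 0 \<le> x \<and> x \<le> \<delta> \<longrightarrow>
      (f j has_vector_derivative f (Suc j) x) (at x) \<and> cmod (f j x) \<le> C * L j) \<longrightarrow>
    (\<forall>j. n < j \<and> j < q \<longrightarrow> f j 0 = 0) \<longrightarrow>
    cmod (f n 0) / fact n \<le> (C + 1) * (2 * exp 1 / \<delta>) ^ n"
proof -
  define K where "K = (\<Sum>i\<le>n. L i)"
  \<comment> \<open>The \<open>j\<close>-th derivative of \<open>f\<close> minus its Taylor
    polynomial will be at most \<open>A * L j\<close>: \<open>C * L j\<close> from \<open>f\<close>
    and \<open>C * K * L j\<close> from the polynomial.\<close>
  define A where "A = C * (1 + K)"
  have K: "0 \<le> K" unfolding K_def by (intro sum_nonneg) (meson L1(2) order_trans zero_le_one)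
  have A: "0 < A" using K \<open>0 < C\<close> by (simp add: A_def)
  \<comment> \<open>Bang's walk is stopped at index \<open>s\<close>, where the decay
    \<open>exp (- s)\<close> already compensates \<open>A\<close>. The steps with index up to
    \<open>s\<close> are given up; \<open>W\<close> is their share of the divergent sum, and the
    rest must still exceed \<open>exp 1 * \<delta>\<close>.\<close>
  obtain s :: nat where s: "A \<le> exp (real s)"
    by (metis real_arch_simple exp_ge_add_one_self add_increasing order_trans zero_le_one)
  define W where "W = (\<Sum>j=1..s. L (j - 1) / L j)"
  have "eventually (\<lambda>q. W + exp 1 * \<delta> \<le> (\<Sum>j=1..q. L (j - 1) / L j)) sequentially"
    using quasi by (simp add: filterlim_at_top)
  then obtain Q0 where Q0: "W + exp 1 * \<delta> \<le> (\<Sum>j=1..q. L (j - 1) / L j)" if "Q0 \<le> q" for q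
    by (auto simp: eventually_sequentially)
  have "cmod (f n 0) / fact n \<le> (C + 1) * (2 * exp 1 / \<delta>) ^ n"
    if q: "max Q0 (max s (Suc n)) \<le> q"
      and f: "\<And>j x. 0 \<le> x \<Longrightarrow> x \<le> \<delta> \<Longrightarrow> (f j has_vector_derivative f (Suc j) x) (at x)"
        "\<And>j x. 0 \<le> x \<Longrightarrow> x \<le> \<delta> \<Longrightarrow> cmod (f j x) \<le> C * L j"
      and flat: "\<And>j. n < j \<Longrightarrow> j < q \<Longrightarrow> f j 0 = 0"
    for q and f :: "nat \<Rightarrow> real \<Rightarrow> complex"
  proof -
    define e where "e = (\<lambda>i. if i \<le> n then f i 0 else 0)"
    define T where "T = (\<lambda>j x. \<Sum>i\<le>n. e (i + j) * complex_of_real x ^ i / fact i)"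
    have T_deriv: "(T j has_vector_derivative T (Suc j) x) (at x)" for j x
      unfolding T_def by (rule taylor_polynomial_has_vector_derivative) (simp add: e_def)
    have T_0: "T j 0 = e j" for j
      unfolding T_def by (subst sum.remove[of _ 0]) (auto intro!: sum.neutral)
    have T_high: "T j x = 0" if "n < j" for j x
      using that by (simp add: T_def e_def)
    \<comment> \<open>On \<open>[0, \<delta>]\<close> the powers of \<open>x\<close> are at most 1.
      The coefficients involved are derivatives of \<open>f\<close> at 0 of distinct orders up to
      \<open>n\<close>, so their sum is at most \<open>C * K\<close>; the factor \<open>L j\<close>
      is at least 1.\<close>
    have T_le: "cmod (T j x) \<le> C * K * L j" if "0 \<le> x" "x \<le> \<delta>" for j x
    proof -
      have "cmod (T j x) \<le> (\<Sum>i\<le>n. cmod (e (i + j)))"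
      proof (unfold T_def, rule sum_norm_le)
        fix i
        have "x ^ i \<le> 1" using that \<delta> by (intro power_le_one) auto
        also have "1 \<le> (fact i :: real)" by (rule fact_ge_1)
        finally have "x ^ i / fact i \<le> 1" by simp
        moreover have "cmod (e (i + j) * of_real x ^ i / fact i) = cmod (e (i + j)) * (x ^ i / fact i)"
          using that by (simp add: norm_mult norm_divide norm_power)
        ultimately show "cmod (e (i + j) * of_real x ^ i / fact i) \<le> cmod (e (i + j))"
          by (simp only: mult_left_le norm_ge_zero)
      qed
      also have "\<dots> = (\<Sum>i\<in>{..n - j} \<inter> {i. i + j \<le> n}. cmod (f (i + j) 0))"
        by (rule sum.mono_neutral_cong_right) (auto simp: e_def)
      also have "\<dots> \<le> (\<Sum>i\<in>{..n - j} \<inter> {i. i + j \<le> n}. C * L (i + j))"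
        using \<delta> f(2)[of 0] by (intro sum_mono) auto
      also have "\<dots> = (\<Sum>i\<in>(\<lambda>i. i + j) ` ({..n - j} \<inter> {i. i + j \<le> n}). C * L i)"
        by (subst sum.reindex) (auto simp: inj_on_def)
      also have "\<dots> \<le> (\<Sum>i\<le>n. C * L i)"
        using \<open>0 < C\<close> log_convex_pos[OF L] by (intro sum_mono2) (auto simp: less_imp_le)
      also have "\<dots> = C * K" by (simp add: K_def sum_distrib_left)
      also have "\<dots> \<le> C * K * L j"
        using mult_left_mono[OF L1(2)[of j], of "C * K"] \<open>0 < C\<close> K by simp
      finally show ?thesis .
    qed
    define g where "g = (\<lambda>j x. (f j x - T j x) / of_real A)"
    have "cmod (g 0 x) \<le> exp (- real s)" if x: "0 \<le> x" "x \<le> \<delta>" for x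
    proof -
      have "cmod (g 0 x) \<le> exp (real 0 - real (q - (q - s))) * L 0"
      proof (rule bang_decay[OF L])
        show "(g j has_vector_derivative g (Suc j) y) (at y)" if "0 \<le> y" "y \<le> \<delta>" for j y
          unfolding g_def
          by (intro has_vector_derivative_divide has_vector_derivative_diff f(1) T_deriv that)
        show "cmod (g j y) \<le> L j" if "0 \<le> y" "y \<le> \<delta>" for j y
        proof -
          have "cmod (f j y - T j y) \<le> C * L j + C * K * L j"
            using f(2)[OF that] T_le[OF that] by (intro norm_triangle_le_diff add_mono)
          then have "cmod (f j y - T j y) \<le> A * L j" by (simp add: A_def algebra_simps)
          then show ?thesis using A by (simp add: g_def norm_divide field_simps)
        qed
        show "g j 0 = 0" if "j < q" for j
          using flat[of j] that by (cases "j \<le> n") (auto simp: g_def T_0 e_def)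
        have "{1..q} = {1..s} \<union> {Suc s..q}" using q by auto
        then have "(\<Sum>j=1..q. L (j - 1) / L j) = W + (\<Sum>j = Suc s..q. L (j - 1) / L j)"
          by (simp add: W_def sum.union_disjoint)
        then have "exp 1 * \<delta> \<le> (\<Sum>j = Suc s..q. L (j - 1) / L j)" using Q0[of q] q by simp
        then have "\<delta> \<le> (\<Sum>j = Suc s..q. L (j - 1) / L j) / exp 1" by (simp add: field_simps)
        also have "\<dots> = (\<Sum>j = Suc s..q. L (j - 1) / (exp 1 * L j))"
          by (simp add: sum_divide_distrib mult.commute)
        finally show "x \<le> (\<Sum>j = Suc (q - (q - s))..q. L (j - 1) / (exp 1 * L j))" using q x by simp
      qed (use x in auto)
      then show ?thesis using q L1 by simp
    qed
    then have g: "A * cmod (g 0 x) \<le> 1" if "0 \<le> x" "x \<le> \<delta>" for x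
      using that s A mult_mono[of A "exp (real s)" "cmod (g 0 x)" "exp (- real s)"]
      by (simp flip: exp_add)
    have "cmod (T 0 x) \<le> C + 1" if "0 \<le> x" "x \<le> \<delta>" for x
    proof -
      have "T 0 x = f 0 x - of_real A * g 0 x" using A by (simp add: g_def)
      then have "cmod (T 0 x) \<le> cmod (f 0 x) + A * cmod (g 0 x)"
        using A norm_triangle_ineq4[of "f 0 x" "of_real A * g 0 x"] by (simp add: norm_mult)
      then show ?thesis using g[OF that] f(2)[OF that, of 0] L1 by simp
    qed
    moreover have "T n x = f n 0" for x
      unfolding T_def by (subst sum.remove[of _ 0]) (auto simp: e_def intro!: sum.neutral)
    \<comment> \<open>With step \<open>\<delta> / n\<close> all nodes of the \<open>n\<close>-th
      difference lie in \<open>[0, \<delta>]\<close>. For \<open>n = 0\<close> the step is 0 and the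
      statement remains true.\<close>
    moreover have "real n * (\<delta> / real n) \<le> \<delta>" using \<delta> by simp
    ultimately have "cmod (f n 0) * (\<delta> / real n) ^ n \<le> 2 ^ n * (C + 1)"
      using \<delta> T_deriv by (intro constant_derivative_le[of n T]) (auto intro: order_trans)
    then have "cmod (f n 0) * (\<delta> / real n) ^ n * (real n / \<delta>) ^ n \<le> 2 ^ n * (C + 1) * (real n / \<delta>) ^ n"
      using \<delta> by (intro mult_right_mono) auto
    moreover have "(\<delta> / real n) ^ n * (real n / \<delta>) ^ n = 1"
      using \<delta> by (cases "n = 0") (auto simp flip: power_mult_distrib)
    ultimately have "cmod (f n 0) \<le> 2 ^ n * (C + 1) * (real n / \<delta>) ^ n"
      by (simp only: mult.assoc mult_1_right)
    also have "\<dots> = 2 ^ n * (C + 1) * (real n ^ n / \<delta> ^ n)"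
      by (simp add: power_divide)
    also have "\<dots> \<le> 2 ^ n * (C + 1) * (exp 1 ^ n * fact n / \<delta> ^ n)"
      using \<delta> \<open>0 < C\<close> by (intro mult_left_mono divide_right_mono power_self_le_exp_fact) auto
    finally show ?thesis by (simp add: field_simps power_mult_distrib power_divide)
  qed
  then show ?thesis by blast
qed

subsection \<open>Algebras generated by power series\<close>

interpretation fps_vs: vector_space "\<lambda>c F. fps_const c * (F :: complex fps)"
  by unfold_locales (auto simp: algebra_simps simp flip: fps_const_add fps_const_mult)

text \<open>Multisets serve as exponents: their sum corresponds to the product of monomials,
  \<open>size\<close> is the total degree, and nonempty multisets are the monomials allowed in an
  algebra without unit.\<close>

definition fps_monomial :: "('i \<Rightarrow> complex fps) \<Rightarrow> 'i multiset \<Rightarrow> complex fps" where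
  "fps_monomial F m = prod_mset (image_mset F m)"

lemma fps_monomial_single: "fps_monomial F {#t#} = F t"
  by (simp add: fps_monomial_def)

lemma span_mult_closed:
  assumes closed: "\<And>x y. x \<in> B \<Longrightarrow> y \<in> B \<Longrightarrow> x * y \<in> B"
    and "x \<in> fps_vs.span B" "y \<in> fps_vs.span B"
  shows "x * y \<in> fps_vs.span B"
  using assms(2)
proof (induction rule: fps_vs.span_induct_alt)
  case base
  show ?case by (simp add: fps_vs.span_zero)
next
  case (step c b x)
  have "b * y \<in> fps_vs.span B"
    using assms(3)
  proof (induction rule: fps_vs.span_induct_alt)
    case base
    show ?case by (simp add: fps_vs.span_zero)
  next
    case (step d b' z)
    have "fps_const d * (b * b') + b * z \<in> fps_vs.span B"
      by (rule fps_vs.span_add[OF fps_vs.span_scale[OF fps_vs.span_base[OF closed[OF \<open>b \<in> B\<close> step.hyps]]] step.IH])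
    then show ?case by (simp add: algebra_simps)
  qed
  then have "fps_const c * (b * y) + x * y \<in> fps_vs.span B"
    using step by (intro fps_vs.span_add fps_vs.span_scale)
  then show ?case by (simp add: algebra_simps)
qed

lemma subalgebra_span:
  assumes "\<And>x y. x \<in> B \<Longrightarrow> y \<in> B \<Longrightarrow> x * y \<in> B"
  shows "subalgebra (\<lambda>c F. fps_const c * F) (fps_vs.span B)"
  using span_mult_closed[OF assms]
  by (auto simp: subalgebra_def intro: fps_vs.span_zero fps_vs.span_add fps_vs.span_scale)

lemma subalgebra_hull: "subalgebra smul (subalgebra smul hull S)"
  by (rule hull_in) (auto simp: subalgebra_def)

text \<open>Monomials of positive degree are closed under products, so their span is a subalgebra,
  and it contains the generators.\<close>

lemma hull_subset_span_monomials:
  "subalgebra (\<lambda>c F. fps_const c * F) hull (F ` T) \<subseteq>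
    fps_vs.span (fps_monomial F ` {m. m \<noteq> {#} \<and> set_mset m \<subseteq> T})"
proof (rule hull_minimal)
  show "F ` T \<subseteq> fps_vs.span (fps_monomial F ` {m. m \<noteq> {#} \<and> set_mset m \<subseteq> T})"
  proof
    fix x assume "x \<in> F ` T"
    then obtain t where t: "t \<in> T" "x = F t" by blast
    show "x \<in> fps_vs.span (fps_monomial F ` {m. m \<noteq> {#} \<and> set_mset m \<subseteq> T})"
      using t by (intro fps_vs.span_base image_eqI[of _ _ "{#t#}"]) (auto simp: fps_monomial_single)
  qed
  show "subalgebra (\<lambda>c F. fps_const c * F)
      (fps_vs.span (fps_monomial F ` {m. m \<noteq> {#} \<and> set_mset m \<subseteq> T}))"
  proof (rule subalgebra_span, elim imageE, simp)
    fix m m' :: "'a multiset"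
    assume m: "m \<noteq> {#} \<and> set_mset m \<subseteq> T" "m' \<noteq> {#} \<and> set_mset m' \<subseteq> T"
    show "fps_monomial F m * fps_monomial F m' \<in> fps_monomial F ` {m. m \<noteq> {#} \<and> set_mset m \<subseteq> T}"
      using m by (intro image_eqI[of _ _ "m + m'"]) (auto simp: fps_monomial_def)
  qed
qed

text \<open>Since \<open>\<phi>\<close> may identify indices, one index is chosen for each vector.
  Vanishing coefficients are then dropped, so a nonempty \<open>A\<close> is a nonzero formal
  combination.\<close>

lemma span_image_representation:
  assumes "x \<in> fps_vs.span (\<phi> ` I)"
  obtains A c where "finite A" "A \<subseteq> I" "\<And>m. m \<in> A \<Longrightarrow> c m \<noteq> 0"
    "x = (\<Sum>m\<in>A. fps_const (c m) * \<phi> m)"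
proof -
  obtain T r where T: "finite T" "T \<subseteq> \<phi> ` I" "x = (\<Sum>a\<in>T. fps_const (r a) * a)"
    using assms unfolding fps_vs.span_explicit by blast
  obtain A where A: "A \<subseteq> I" "inj_on \<phi> A" "T = \<phi> ` A"
    using T(2) by (auto simp: subset_image_inj)
  show ?thesis
  proof
    show "finite {m \<in> A. r (\<phi> m) \<noteq> 0}" using T(1) A by (simp add: finite_image_iff)
    show "x = (\<Sum>m\<in>{m \<in> A. r (\<phi> m) \<noteq> 0}. fps_const (r (\<phi> m)) * \<phi> m)"
      using T(1) A finite_image_iff[of \<phi> A] unfolding T(3)
      by (subst A(3), subst sum.reindex[OF A(2)]) (auto intro!: sum.mono_neutral_right)
  qed (use A in auto)
qed

text \<open>The hypothesis \<open>avoid\<close> contains two facts: values of nonzero polynomials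
  without constant term lie outside \<open>X\<close>, and they are not 0. The second is algebraic
  independence, which makes the generating set minimal and \<open>F\<close> injective on
  \<open>I\<close>.\<close>

lemma continuum_algebrable_inI:
  fixes F :: "real \<Rightarrow> complex fps"
  assumes \<A>: "subalgebra (\<lambda>c F. fps_const c * F) \<A>" and F\<A>: "\<And>t. t \<in> I \<Longrightarrow> F t \<in> \<A>"
    and I: "I \<approx> (UNIV :: real set)"
    and avoid: "\<And>A c. finite A \<Longrightarrow> A \<noteq> {} \<Longrightarrow>
      (\<And>m. m \<in> A \<Longrightarrow> m \<noteq> {#} \<and> set_mset m \<subseteq> I \<and> c m \<noteq> 0) \<Longrightarrow>
      (\<Sum>m\<in>A. fps_const (c m) * fps_monomial F m) \<notin> insert 0 X"
  shows "continuum_algebrable_in \<A> (\<A> - X)"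
  unfolding continuum_algebrable_in_def algebrable_in_def
proof (intro exI conjI)
  let ?hull = "(hull) (subalgebra (\<lambda>c F. fps_const c * (F :: complex fps)))"
  let ?C = "?hull (F ` I)"
  show "subalgebra (\<lambda>c F. fps_const c * F) ?C" by (rule subalgebra_hull)
  show CA: "?C \<subseteq> \<A>" using \<A> F\<A> by (intro hull_minimal) auto
  show "?C \<subseteq> \<A> - X \<union> {0}"
  proof
    fix x assume x: "x \<in> ?C"
    then have "x \<in> fps_vs.span (fps_monomial F ` {m. m \<noteq> {#} \<and> set_mset m \<subseteq> I})"
      using hull_subset_span_monomials by blast
    then obtain A c where A: "finite A" "A \<subseteq> {m. m \<noteq> {#} \<and> set_mset m \<subseteq> I}"
      "\<And>m. m \<in> A \<Longrightarrow> c m \<noteq> 0" "x = (\<Sum>m\<in>A. fps_const (c m) * fps_monomial F m)"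
      by (rule span_image_representation) blast
    show "x \<in> \<A> - X \<union> {0}"
    proof (cases "A = {}")
      case False
      then have "x \<notin> insert 0 X" unfolding A(4) using A(1-3) by (intro avoid) auto
      then show ?thesis using x CA by auto
    qed (use A in simp)
  qed
  have indep: "F t \<notin> ?hull (F ` J)" if t: "t \<in> I" "t \<notin> J" and J: "J \<subseteq> I" for t J
  proof
    assume "F t \<in> ?hull (F ` J)"
    then have "F t \<in> fps_vs.span (fps_monomial F ` {m. m \<noteq> {#} \<and> set_mset m \<subseteq> J})"
      using hull_subset_span_monomials by blast
    then obtain A c where A: "finite A" "A \<subseteq> {m. m \<noteq> {#} \<and> set_mset m \<subseteq> J}"
      "\<And>m. m \<in> A \<Longrightarrow> c m \<noteq> 0" "F t = (\<Sum>m\<in>A. fps_const (c m) * fps_monomial F m)"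
      by (rule span_image_representation) blast
    \<comment> \<open>Moving \<open>F t\<close> to the other side gives a polynomial relation, which
      is nontrivial because the monomial \<open>{#t#}\<close> does not occur in
      \<open>A\<close>.\<close>
    define c' where "c' = c({#t#} := -1)"
    have t': "{#t#} \<notin> A" using A(2) t by auto
    have "(\<Sum>m\<in>insert {#t#} A. fps_const (c' m) * fps_monomial F m) \<notin> insert 0 X"
      using A(1-3) t J by (intro avoid) (auto simp: c'_def)
    moreover have "(\<Sum>m\<in>A. fps_const (c' m) * fps_monomial F m) = F t"
      unfolding A(4) using t' by (intro sum.cong) (auto simp: c'_def)
    then have "(\<Sum>m\<in>insert {#t#} A. fps_const (c' m) * fps_monomial F m) = 0"
      using A(1) t' by (simp add: c'_def fps_monomial_single flip: fps_const_neg)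
    ultimately show False by simp
  qed
  show "minimal_generators (\<lambda>c F. fps_const c * F) (F ` I) ?C"
    unfolding minimal_generators_def
  proof (intro conjI allI impI refl)
    fix T assume T: "T \<subset> F ` I"
    then obtain t where t: "t \<in> I" "F t \<notin> T" by blast
    \<comment> \<open>All indices whose generator lies in \<open>T\<close>; the index
      \<open>t\<close> is not among them.\<close>
    define J where "J = {i \<in> I. F i \<in> T}"
    have "T = F ` J" using T by (auto simp: J_def)
    moreover have "F t \<notin> ?hull (F ` J)" using t by (intro indep) (auto simp: J_def)
    moreover have "F t \<in> ?C" using t by (intro hull_inc) auto
    ultimately show "?hull T \<noteq> ?C" by auto
  qed
  have "inj_on F I"
  proof (rule inj_onI, rule ccontr)
    fix s t assume "s \<in> I" "t \<in> I" "F s = F t" "s \<noteq> t"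
    then show False using indep[of t "{s}"] by (auto simp: hull_inc)
  qed
  then have "F ` I \<approx> I" by (simp add: inj_on_image_eqpoll_self)
  then show "F ` I \<approx> (UNIV :: real set)" using I eqpoll_trans by blast
qed

subsection \<open>Weighted spaces of power series\<close>

lemma weight_sequence_log_convex:
  assumes "weight_sequence M"
  shows "log_convex M"
  unfolding log_convex_def
proof (intro conjI allI)
  fix j
  show "0 < M j" using assms by (simp add: weight_sequence_def)
  have "(M (Suc j))\<^sup>2 \<le> M (Suc j - 1) * M (Suc j + 1)"
    using assms unfolding weight_sequence_def by (metis le_add1 plus_1_eq_Suc)
  then show "(M (Suc j))\<^sup>2 \<le> M j * M (Suc (Suc j))" by simp
qed

lemma weight_sequence_ge_1:
  assumes "weight_sequence M"
  shows "1 \<le> M j"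
proof (induction j)
  case (Suc j)
  have "M (Suc 0) / M 0 \<le> M (Suc j) / M j"
    using weight_sequence_log_convex[OF assms] by (rule log_convex_ratio_mono) simp
  moreover have "1 \<le> M (Suc 0) / M 0" "0 < M j" using assms by (auto simp: weight_sequence_def)
  ultimately have "1 \<le> M (Suc j) / M j" by linarith
  then have "M j \<le> M (Suc j)" using \<open>0 < M j\<close> by simp
  then show ?case using Suc by simp
qed (use assms in \<open>simp add: weight_sequence_def\<close>)

text \<open>Used to absorb the factor \<open>h ^ j\<close> in the bounds for derivatives into the
  weight sequence.\<close>

lemma log_convex_geometric:
  assumes "log_convex M" "0 < h"
  shows "log_convex (\<lambda>j. h ^ j * M j)"
  unfolding log_convex_def
proof (intro conjI allI)
  fix j
  show "0 < h ^ j * M j" using assms by (simp add: log_convex_pos)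
  have "(h ^ Suc j)\<^sup>2 * (M (Suc j))\<^sup>2 \<le> (h ^ Suc j)\<^sup>2 * (M j * M (Suc (Suc j)))"
    using assms by (intro mult_left_mono) (auto simp: log_convex_def)
  then show "(h ^ Suc j * M (Suc j))\<^sup>2 \<le> h ^ j * M j * (h ^ Suc (Suc j) * M (Suc (Suc j)))"
    by (simp add: power_mult_distrib power2_eq_square mult_ac)
qed

text \<open>Every ratio of consecutive entries is multiplied by \<open>1 / h\<close>, so the sum
  still diverges.\<close>

lemma quasianalytic_geometric:
  assumes "quasianalytic M" "0 < h"
  shows "quasianalytic (\<lambda>j. h ^ j * M j)"
proof -
  have "(\<Sum>j=1..n. h ^ (j - 1) * M (j - 1) / (h ^ j * M j)) = (1 / h) * (\<Sum>j=1..n. M (j - 1) / M j)" for n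
    unfolding sum_distrib_left
  proof (rule sum.cong)
    fix j assume "j \<in> {1..n}"
    then have "h ^ j = h * h ^ (j - 1)" by (cases j) auto
    then show "h ^ (j - 1) * M (j - 1) / (h ^ j * M j) = (1 / h) * (M (j - 1) / M j)"
      using assms(2) by simp
  qed simp
  moreover have "filterlim (\<lambda>n. (1 / h) * (\<Sum>j=1..n. M (j - 1) / M j)) at_top sequentially"
    using assms by (intro filterlim_tendsto_pos_mult_at_top[OF tendsto_const]) (auto simp: quasianalytic_def)
  ultimately show ?thesis by (simp add: quasianalytic_def)
qed

text \<open>Raising \<open>i\<close> by one multiplies the left side by the ratio at
  \<open>i\<close> and the right side by the ratio at \<open>i + j\<close>, which is no
  smaller.\<close>

lemma log_convex_supermultiplicative:
  assumes "log_convex L" "L 0 = 1"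
  shows "L i * L j \<le> L (i + j)"
proof (induction i)
  case (Suc i)
  have p: "0 < L k" for k using assms(1) by (rule log_convex_pos)
  have r: "L (Suc i) / L i \<le> L (Suc (i + j)) / L (i + j)"
    using assms(1) by (rule log_convex_ratio_mono) simp
  have "L (Suc i) * L j = (L (Suc i) / L i) * (L i * L j)" using p[of i] by simp
  also have "\<dots> \<le> (L (Suc (i + j)) / L (i + j)) * L (i + j)"
    using r Suc p by (intro mult_mono) (auto simp: less_imp_le)
  also have "\<dots> = L (Suc i + j)" using p[of "i + j"] by simp
  finally show ?case .
qed (simp add: assms)

lemma fps_bounded_iff:
  assumes "\<And>j. 0 < M j" "0 < h"
  shows "fps_bounded M h F \<longleftrightarrow> (\<exists>C. \<forall>j. cmod (fps_nth F j) \<le> C * (h ^ j * div_fact M j))"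
proof -
  have "0 < h ^ j * div_fact M j" for j using assms by (simp add: div_fact_def)
  then show ?thesis
    unfolding fps_bounded_def bdd_above_def by (auto simp: pos_divide_le_eq)
qed

text \<open>By supermultiplicativity, the \<open>i\<close>-th term of the Cauchy product is at most
  the target weight times \<open>j choose i\<close>. The binomial coefficients add up to
  \<open>2 ^ j\<close>, whence the factor 2 at \<open>h\<close>.\<close>

lemma fps_bounded_mult:
  assumes N: "weight_sequence N" and "0 < h" and FG: "fps_bounded N h F" "fps_bounded N h G"
  shows "fps_bounded N (2 * h) (F * G)"
proof -
  have lc: "log_convex N" and N0: "N 0 = 1"
    using N weight_sequence_log_convex by (auto simp: weight_sequence_def)
  have p: "0 < N k" for k using lc by (rule log_convex_pos)
  note bnd = fps_bounded_iff[of N, OF p]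
  obtain C D where C: "\<And>j. cmod (fps_nth F j) \<le> C * (h ^ j * div_fact N j)"
    and D: "\<And>j. cmod (fps_nth G j) \<le> D * (h ^ j * div_fact N j)"
    using FG unfolding bnd[OF \<open>0 < h\<close>] by blast
  have pos: "0 < h ^ j * div_fact N j" for j using \<open>0 < h\<close> p by (simp add: div_fact_def)
  have "0 \<le> C * (h ^ 0 * div_fact N 0)" using C[of 0] norm_ge_zero order_trans by blast
  then have "0 \<le> C" using pos[of 0] by (simp add: zero_le_mult_iff)
  have "0 \<le> D * (h ^ 0 * div_fact N 0)" using D[of 0] norm_ge_zero order_trans by blast
  then have "0 \<le> D" using pos[of 0] by (simp add: zero_le_mult_iff)
  have "cmod (fps_nth (F * G) j) \<le> (C * D) * ((2 * h) ^ j * div_fact N j)" for j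
  proof -
    have "cmod (fps_nth (F * G) j) \<le> (\<Sum>i=0..j. C * D * (h ^ j * div_fact N j) * real (j choose i))"
      unfolding fps_mult_nth
    proof (rule sum_norm_le)
      fix i assume "i \<in> {0..j}"
      then have i: "i \<le> j" by simp
      have "cmod (fps_nth F i * fps_nth G (j - i))
          \<le> (C * (h ^ i * div_fact N i)) * (D * (h ^ (j - i) * div_fact N (j - i)))"
        unfolding norm_mult using C D \<open>0 \<le> C\<close> pos by (intro mult_mono) (auto simp: less_imp_le)
      also have "\<dots> = C * D * h ^ j * (N i * N (j - i)) / (fact i * fact (j - i))"
        using i by (simp add: div_fact_def mult_ac flip: power_add)
      also have "\<dots> \<le> C * D * h ^ j * N j / (fact i * fact (j - i))"
        using log_convex_supermultiplicative[of N i "j - i"] lc N0 i \<open>0 \<le> C\<close> \<open>0 \<le> D\<close> \<open>0 < h\<close>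
        by (intro divide_right_mono mult_left_mono) auto
      also have "\<dots> = C * D * (h ^ j * div_fact N j) * real (j choose i)"
        using i by (simp add: div_fact_def binomial_fact)
      finally show "cmod (fps_nth F i * fps_nth G (j - i))
          \<le> C * D * (h ^ j * div_fact N j) * real (j choose i)" .
    qed
    also have "\<dots> = C * D * (h ^ j * div_fact N j) * 2 ^ j"
      using choose_row_sum[of j] by (simp add: atMost_atLeast0 flip: sum_distrib_left of_nat_sum)
    finally show ?thesis by (simp add: power_mult_distrib mult_ac)
  qed
  then show ?thesis using bnd[of "2 * h"] \<open>0 < h\<close> by auto
qed

lemma fps_bounded_add:
  assumes "\<And>j. 0 < N j" "0 < h" "fps_bounded N h F" "fps_bounded N h G"
  shows "fps_bounded N h (F + G)"
proof -
  note bnd = fps_bounded_iff[OF assms(1,2)]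
  obtain C D where C: "\<And>j. cmod (fps_nth F j) \<le> C * (h ^ j * div_fact N j)"
    and D: "\<And>j. cmod (fps_nth G j) \<le> D * (h ^ j * div_fact N j)"
    using assms(3,4) unfolding bnd by blast
  have "cmod (fps_nth (F + G) j) \<le> (C + D) * (h ^ j * div_fact N j)" for j
    using norm_triangle_mono[OF C[of j] D[of j]] by (simp add: distrib_right)
  then show ?thesis unfolding bnd by blast
qed

lemma fps_bounded_scale:
  assumes "\<And>j. 0 < N j" "0 < h" "fps_bounded N h F"
  shows "fps_bounded N h (fps_const c * F)"
proof -
  note bnd = fps_bounded_iff[OF assms(1,2)]
  obtain C where C: "\<And>j. cmod (fps_nth F j) \<le> C * (h ^ j * div_fact N j)"
    using assms(3) unfolding bnd by blast
  have "cmod (fps_nth (fps_const c * F) j) \<le> (cmod c * C) * (h ^ j * div_fact N j)" for j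
    using mult_left_mono[OF C[of j], of "cmod c"] by (simp add: norm_mult mult.assoc)
  then show ?thesis unfolding bnd by blast
qed

lemma fps_bounded_zero: "fps_bounded N h 0"
  by (simp add: fps_bounded_def)

lemma fps_bounded_mono:
  assumes "\<And>j. 0 < M j" "\<And>j. M j \<le> N j" "0 < h" "h \<le> k" "fps_bounded M h F"
  shows "fps_bounded N k F"
proof -
  have N: "0 < N j" for j using assms(1,2) by (meson less_le_trans)
  obtain C where C: "\<And>j. cmod (fps_nth F j) \<le> C * (h ^ j * div_fact M j)"
    using assms(5) unfolding fps_bounded_iff[OF assms(1,3)] by blast
  have "cmod (fps_nth F j) \<le> \<bar>C\<bar> * (k ^ j * div_fact N j)" for j
  proof -
    have "C * (h ^ j * div_fact M j) \<le> \<bar>C\<bar> * (k ^ j * div_fact N j)"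
      using assms(1)[of j] assms(2-4) by (intro mult_mono power_mono divide_right_mono)
        (auto simp: div_fact_def divide_right_mono less_imp_le)
    then show ?thesis using C[of j] by linarith
  qed
  then show ?thesis using fps_bounded_iff[of N k, OF N] assms(3,4) by auto
qed

lemma weight_matrixD:
  assumes "weight_matrix \<N>" "0 < \<alpha>"
  shows "weight_sequence (\<N> \<alpha>)" "0 < \<N> \<alpha> j" "\<alpha> \<le> \<beta> \<Longrightarrow> \<N> \<alpha> j \<le> \<N> \<beta> j"
  using assms by (auto simp: weight_matrix_def weight_sequence_def)

lemma subalgebra_F_Beurling:
  assumes "weight_matrix \<N>"
  shows "subalgebra (\<lambda>c F. fps_const c * F) (F_Beurling \<N>)"
  unfolding subalgebra_def F_Beurling_def
proof (intro conjI ballI allI CollectI impI)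
  fix F G and \<alpha> h :: real
  assume F: "F \<in> {F. \<forall>\<alpha>>0. \<forall>h>0. fps_bounded (\<N> \<alpha>) h F}"
    and G: "G \<in> {F. \<forall>\<alpha>>0. \<forall>h>0. fps_bounded (\<N> \<alpha>) h F}" and pos: "0 < \<alpha>" "0 < h"
  show "fps_bounded (\<N> \<alpha>) h (F + G)"
    using F G pos weight_matrixD(2)[OF assms pos(1)] by (intro fps_bounded_add) auto
  \<comment> \<open>All \<open>h\<close> are available in the Beurling case, so \<open>h / 2\<close>
    makes up for the doubling.\<close>
  have "fps_bounded (\<N> \<alpha>) (2 * (h / 2)) (F * G)"
    using F G pos weight_matrixD(1)[OF assms pos(1)] by (intro fps_bounded_mult) auto
  then show "fps_bounded (\<N> \<alpha>) h (F * G)" by simp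
next
  fix F c and \<alpha> h :: real
  assume F: "F \<in> {F. \<forall>\<alpha>>0. \<forall>h>0. fps_bounded (\<N> \<alpha>) h F}" and pos: "0 < \<alpha>" "0 < h"
  then show "fps_bounded (\<N> \<alpha>) h (fps_const c * F)"
    using weight_matrixD(2)[OF assms pos(1)] by (intro fps_bounded_scale) auto
qed (rule fps_bounded_zero)

lemma subalgebra_F_Roumieu:
  assumes "weight_matrix \<N>"
  shows "subalgebra (\<lambda>c F. fps_const c * F) (F_Roumieu \<N>)"
  unfolding subalgebra_def F_Roumieu_def
proof (intro conjI ballI allI)
  show "0 \<in> {F. \<exists>\<alpha>>0. \<exists>h>0. fps_bounded (\<N> \<alpha>) h F}"
    using fps_bounded_zero zero_less_one by blast
next
  fix F G
  assume "F \<in> {F. \<exists>\<alpha>>0. \<exists>h>0. fps_bounded (\<N> \<alpha>) h F}" "G \<in> {F. \<exists>\<alpha>>0. \<exists>h>0. fps_bounded (\<N> \<alpha>) h F}"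
  then obtain \<alpha> h \<beta> k where F: "0 < \<alpha>" "0 < h" "fps_bounded (\<N> \<alpha>) h F"
    and G: "0 < \<beta>" "0 < k" "fps_bounded (\<N> \<beta>) k G" by blast
  \<comment> \<open>Monotonicity in the index and in \<open>h\<close> brings both series under one
    common bound.\<close>
  define \<gamma> l where "\<gamma> = max \<alpha> \<beta>" and "l = max h k"
  have pos: "0 < \<gamma>" "0 < l" using F G by (auto simp: \<gamma>_def l_def)
  have "fps_bounded (\<N> \<gamma>) l F"
    using F weight_matrixD[OF assms, of \<alpha>] by (intro fps_bounded_mono[of "\<N> \<alpha>" "\<N> \<gamma>" h l]) (auto simp: \<gamma>_def l_def)
  moreover have "fps_bounded (\<N> \<gamma>) l G"
    using G weight_matrixD[OF assms, of \<beta>] by (intro fps_bounded_mono[of "\<N> \<beta>" "\<N> \<gamma>" k l]) (auto simp: \<gamma>_def l_def)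
  ultimately have "fps_bounded (\<N> \<gamma>) l (F + G)" "fps_bounded (\<N> \<gamma>) (2 * l) (F * G)"
    using weight_matrixD[OF assms pos(1)] pos by (auto intro!: fps_bounded_add fps_bounded_mult)
  then show "F + G \<in> {F. \<exists>\<alpha>>0. \<exists>h>0. fps_bounded (\<N> \<alpha>) h F}"
    "F * G \<in> {F. \<exists>\<alpha>>0. \<exists>h>0. fps_bounded (\<N> \<alpha>) h F}"
    using pos mult_pos_pos[OF zero_less_numeral pos(2)] by blast+
next
  fix F c
  assume "F \<in> {F. \<exists>\<alpha>>0. \<exists>h>0. fps_bounded (\<N> \<alpha>) h F}"
  then obtain \<alpha> h where F: "0 < \<alpha>" "0 < h" "fps_bounded (\<N> \<alpha>) h F" by blast
  then have "fps_bounded (\<N> \<alpha>) h (fps_const c * F)"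
    using weight_matrixD(2)[OF assms F(1)] by (intro fps_bounded_scale) auto
  then show "fps_const c * F \<in> {F. \<exists>\<alpha>>0. \<exists>h>0. fps_bounded (\<N> \<alpha>) h F}"
    using F by blast
qed

subsection \<open>Dominating exponentials\<close>

lemma sum_mset_eq_sum_count:
  fixes f :: "'a \<Rightarrow> real"
  assumes "finite T" "set_mset m \<subseteq> T"
  shows "(\<Sum>t\<in>#m. f t) = (\<Sum>t\<in>T. real (count m t) * f t)"
  using assms(2)
proof (induction m)
  case (add a m)
  have "(\<Sum>t\<in>T. real (count (add_mset a m) t) * f t)
      = (\<Sum>t\<in>T. real (count m t) * f t + (if t = a then f t else 0))"
    by (intro sum.cong) (auto simp: algebra_simps)
  also have "\<dots> = (\<Sum>t\<in>T. real (count m t) * f t) + f a"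
    using add.prems assms(1) by (simp add: sum.distrib)
  finally show ?case using add by simp
qed simp

text \<open>The logarithm of the monomial with exponent \<open>m\<close> when the variable with
  index \<open>t\<close> has the value \<open>exp (s powr t)\<close>.\<close>

definition exponent_sum :: "real multiset \<Rightarrow> real \<Rightarrow> real" where
  "exponent_sum m s = (\<Sum>t\<in>#m. s powr t)"

lemma exponent_sum_nonneg: "0 \<le> exponent_sum m s"
  unfolding exponent_sum_def by (induction m) auto

lemma powr_at_top_pos:
  fixes u :: real
  assumes "0 < u"
  shows "filterlim (\<lambda>s. s powr u) at_top at_top"
proof -
  have "filterlim (\<lambda>s. exp (u * ln s)) at_top at_top"
    by (intro filterlim_compose[OF exp_at_top] filterlim_tendsto_pos_mult_at_top[OF tendsto_const assms] ln_at_top)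
  moreover have "eventually (\<lambda>s. s powr u = exp (u * ln s)) at_top"
    using eventually_gt_at_top[of 0] by eventually_elim (simp add: powr_def)
  ultimately show ?thesis by (subst filterlim_cong[OF refl refl])
qed

text \<open>The difference is a finite combination of powers of \<open>s\<close>. The largest
  exponent \<open>u\<close> whose multiplicities in \<open>m\<close> and \<open>m'\<close> differ
  dominates, and the sign of its coefficient decides which of the two limits holds.\<close>

lemma exponent_sum_diff_at_top:
  assumes "m \<noteq> m'" and pos: "\<And>t. t \<in># m + m' \<Longrightarrow> 0 < t"
  shows "filterlim (\<lambda>s. exponent_sum m s - exponent_sum m' s) at_top at_top
    \<or> filterlim (\<lambda>s. exponent_sum m' s - exponent_sum m s) at_top at_top"
proof -
  define D where "D = {t. count m t \<noteq> count m' t}"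
  define u where "u = Max D"
  have DT: "D \<subseteq> set_mset m \<union> set_mset m'"
    by (auto simp: D_def) (metis count_eq_zero_iff)
  then have D: "finite D" "D \<noteq> {}"
    using assms(1) multiset_eqI[of m m'] by (auto simp: D_def intro: finite_subset)
  then have uD: "u \<in> D" by (simp add: u_def)
  then have "0 < u" using DT pos by auto
  have one_side: "filterlim (\<lambda>s. exponent_sum a s - exponent_sum b s) at_top at_top"
    if ab: "set_mset a \<union> set_mset b = set_mset m \<union> set_mset m'" "D = {t. count a t \<noteq> count b t}"
      and u: "count b u < count a u" for a b
  proof -
    define w where "w = (\<lambda>t. real (count a t) - real (count b t))"
    have eq: "exponent_sum a s - exponent_sum b s = (\<Sum>t\<in>D. w t * s powr (t - u)) * s powr u" if "0 < s" for s
    proof -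
      let ?T = "set_mset a \<union> set_mset b"
      have "exponent_sum a s - exponent_sum b s = (\<Sum>t\<in>?T. w t * s powr t)"
        unfolding exponent_sum_def w_def
        by (subst (1 2) sum_mset_eq_sum_count[of ?T])
           (auto simp: algebra_simps sum_subtractf)
      also have "\<dots> = (\<Sum>t\<in>D. w t * s powr t)"
        using DT ab by (intro sum.mono_neutral_right) (auto simp: w_def)
      also have "\<dots> = (\<Sum>t\<in>D. w t * s powr (t - u)) * s powr u"
        using that by (simp add: sum_distrib_right mult.assoc flip: powr_add)
      finally show ?thesis .
    qed
    \<comment> \<open>After division by \<open>s powr u\<close> all other exponents are negative, so
      only the coefficient of \<open>u\<close> survives.\<close>
    have "((\<lambda>s. \<Sum>t\<in>D. w t * s powr (t - u)) \<longlongrightarrow> (\<Sum>t\<in>D. if t = u then w u else 0)) at_top"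
    proof (intro tendsto_sum)
      fix t assume "t \<in> D"
      show "((\<lambda>s. w t * s powr (t - u)) \<longlongrightarrow> (if t = u then w u else 0)) at_top"
      proof (cases "t = u")
        case True
        have "eventually (\<lambda>s. w t * s powr (t - u) = w u) at_top"
          using eventually_gt_at_top[of 0] by eventually_elim (simp add: True)
        then show ?thesis using True by (simp add: tendsto_eventually)
      next
        case False
        then have "t - u < 0" using \<open>t \<in> D\<close> D by (simp add: u_def order_less_le)
        then have "((\<lambda>s. s powr (t - u)) \<longlongrightarrow> 0) at_top"
          by (rule tendsto_neg_powr) (rule filterlim_ident)
        then show ?thesis using False by (auto intro: tendsto_mult_right_zero)
      qed
    qed
    then have lim: "((\<lambda>s. \<Sum>t\<in>D. w t * s powr (t - u)) \<longlongrightarrow> w u) at_top"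
      using D uD by simp
    have "filterlim (\<lambda>s. (\<Sum>t\<in>D. w t * s powr (t - u)) * s powr u) at_top at_top"
      using u \<open>0 < u\<close> by (intro filterlim_tendsto_pos_mult_at_top[OF lim] powr_at_top_pos) (auto simp: w_def)
    moreover have "eventually (\<lambda>s. exponent_sum a s - exponent_sum b s
        = (\<Sum>t\<in>D. w t * s powr (t - u)) * s powr u) at_top"
      using eventually_gt_at_top[of 0] by eventually_elim (rule eq)
    ultimately show ?thesis by (subst filterlim_cong[OF refl refl])
  qed
  from uD have "count m' u < count m u \<or> count m u < count m' u" by (auto simp: D_def)
  then show ?thesis
  proof
    assume "count m' u < count m u"
    then show ?thesis by (intro disjI1 one_side) (auto simp: D_def)
  next
    assume "count m u < count m' u"
    then show ?thesis by (intro disjI2 one_side) (auto simp: D_def)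
  qed
qed

text \<open>Any two multisets in \<open>A\<close> are comparable and the comparison is transitive,
  since two divergent differences add up; a finite set then has a largest element.\<close>

lemma dominating_multiset:
  assumes "finite A" "A \<noteq> {}" "\<And>m t. m \<in> A \<Longrightarrow> t \<in># m \<Longrightarrow> 0 < t"
  shows "\<exists>m0\<in>A. \<forall>m\<in>A - {m0}. filterlim (\<lambda>s. exponent_sum m0 s - exponent_sum m s) at_top at_top"
  using assms
proof (induction rule: finite_ne_induct)
  case (insert x A)
  then obtain m0 where m0: "m0 \<in> A"
    "\<And>m. m \<in> A - {m0} \<Longrightarrow> filterlim (\<lambda>s. exponent_sum m0 s - exponent_sum m s) at_top at_top"
    by blast
  have "x \<noteq> m0" using insert.hyps m0(1) by metis
  then consider "filterlim (\<lambda>s. exponent_sum m0 s - exponent_sum x s) at_top at_top"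
    | "filterlim (\<lambda>s. exponent_sum x s - exponent_sum m0 s) at_top at_top"
    using exponent_sum_diff_at_top[of x m0] insert.prems m0(1) by auto
  then show ?case
  proof cases
    case 1
    then show ?thesis using m0 by (intro bexI[of _ m0]) auto
  next
    case 2
    have "filterlim (\<lambda>s. exponent_sum x s - exponent_sum m s) at_top at_top" if "m \<in> A" for m
    proof (cases "m = m0")
      case False
      then show ?thesis
        using filterlim_at_top_add_at_top[OF 2 m0(2)[of m]] that by simp
    qed (use 2 in simp)
    then show ?thesis by (intro bexI[of _ x]) auto
  qed
qed simp

text \<open>Divided by the exponential of the dominating multiset \<open>m0\<close>, the sum tends
  to \<open>c m0\<close>, so its modulus is eventually above half of \<open>cmod (c m0)\<close>.
  Multiplying back only enlarges it, as \<open>exponent_sum\<close> is nonnegative.\<close>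

lemma exponential_sum_bounded_below:
  fixes c :: "real multiset \<Rightarrow> complex"
  assumes A: "finite A" "A \<noteq> {}" "\<And>m t. m \<in> A \<Longrightarrow> t \<in># m \<Longrightarrow> 0 < t"
    and c: "\<And>m. m \<in> A \<Longrightarrow> c m \<noteq> 0"
  shows "\<exists>\<epsilon>>0. eventually (\<lambda>s. \<epsilon> \<le> cmod (\<Sum>m\<in>A. c m * of_real (exp (exponent_sum m s)))) at_top"
proof -
  have "\<exists>m0\<in>A. \<forall>m\<in>A - {m0}. filterlim (\<lambda>s. exponent_sum m0 s - exponent_sum m s) at_top at_top"
    by (rule dominating_multiset) (fact A)+
  then obtain m0 where m0: "m0 \<in> A"
    "\<And>m. m \<in> A - {m0} \<Longrightarrow> filterlim (\<lambda>s. exponent_sum m0 s - exponent_sum m s) at_top at_top"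
    by blast
  let ?S = "\<lambda>s. \<Sum>m\<in>A. c m * of_real (exp (exponent_sum m s - exponent_sum m0 s))"
  have "(?S \<longlongrightarrow> (\<Sum>m\<in>A. if m = m0 then c m0 else 0)) at_top"
  proof (intro tendsto_sum)
    fix m assume "m \<in> A"
    show "((\<lambda>s. c m * of_real (exp (exponent_sum m s - exponent_sum m0 s)))
        \<longlongrightarrow> (if m = m0 then c m0 else 0)) at_top"
    proof (cases "m = m0")
      case False
      then have "filterlim (\<lambda>s. exponent_sum m s - exponent_sum m0 s) at_bot at_top"
        using iffD1[OF filterlim_uminus_at_top m0(2)[of m]] \<open>m \<in> A\<close> by (simp only: minus_diff_eq) blast
      then have "((\<lambda>s. exp (exponent_sum m s - exponent_sum m0 s)) \<longlongrightarrow> 0) at_top"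
        by (rule filterlim_compose[OF exp_at_bot])
      then have "((\<lambda>s. c m * of_real (exp (exponent_sum m s - exponent_sum m0 s))) \<longlongrightarrow> c m * of_real 0) at_top"
        by (intro tendsto_mult tendsto_const tendsto_of_real)
      then show ?thesis using False by simp
    qed simp
  qed
  then have "(?S \<longlongrightarrow> c m0) at_top" using A(1) m0(1) by (simp only: sum.delta if_True)
  then have "((\<lambda>s. cmod (?S s)) \<longlongrightarrow> cmod (c m0)) at_top" by (rule tendsto_norm)
  then have "eventually (\<lambda>s. cmod (c m0) / 2 < cmod (?S s)) at_top"
    by (rule order_tendstoD(1)) (simp add: c[OF m0(1)])
  then have "eventually (\<lambda>s. cmod (c m0) / 2 \<le> cmod (\<Sum>m\<in>A. c m * of_real (exp (exponent_sum m s)))) at_top"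
  proof eventually_elim
    case (elim s)
    have "(\<Sum>m\<in>A. c m * of_real (exp (exponent_sum m s))) = of_real (exp (exponent_sum m0 s)) * ?S s"
      
      by (subst sum_distrib_left, intro sum.cong refl) (simp add: exp_diff)
    then have "cmod (\<Sum>m\<in>A. c m * of_real (exp (exponent_sum m s))) = exp (exponent_sum m0 s) * cmod (?S s)"
      by (simp only: norm_mult norm_of_real abs_exp_cancel)
    moreover have "1 * cmod (?S s) \<le> exp (exponent_sum m0 s) * cmod (?S s)"
      using exponent_sum_nonneg[of m0 s] by (intro mult_right_mono) auto
    ultimately show ?case using elim by linarith
  qed
  then show ?thesis using c[OF m0(1)] by (intro exI[of _ "cmod (c m0) / 2"]) auto
qed

subsection \<open>Lacunary series\<close>

text \<open>Below \<open>q\<close>, each factor can contribute only indices up to \<open>p\<close>.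
  So the total index is at most \<open>size m * p\<close>, and equality forces the index
  \<open>p\<close> in every factor.\<close>

lemma fps_monomial_gap:
  fixes F :: "'i \<Rightarrow> complex fps"
  assumes "\<And>t j. t \<in># m \<Longrightarrow> p < j \<Longrightarrow> j < q \<Longrightarrow> fps_nth (F t) j = 0"
  shows "(\<forall>j. size m * p < j \<and> j < q \<longrightarrow> fps_nth (fps_monomial F m) j = 0)
    \<and> (size m * p < q \<longrightarrow> fps_nth (fps_monomial F m) (size m * p) = (\<Prod>t\<in>#m. fps_nth (F t) p))"
  using assms
proof (induction m)
  case empty
  show ?case by (simp add: fps_monomial_def)
next
  case (add t m)
  let ?G = "fps_monomial F m"
  have G: "fps_nth ?G j = 0" if "size m * p < j" "j < q" for j
    using add that by auto
  have G0: "fps_nth ?G (size m * p) = (\<Prod>t\<in>#m. fps_nth (F t) p)" if "size m * p < q"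
    using add that by auto
  have F: "fps_nth (F t) j = 0" if "p < j" "j < q" for j using add.prems[of t] that by auto
  have split: "fps_monomial F (add_mset t m) = F t * ?G" by (simp add: fps_monomial_def)
  have "fps_nth (F t * ?G) j = 0" if "p + size m * p < j" "j < q" for j
    unfolding fps_mult_nth
  proof (rule sum.neutral, rule ballI)
    fix i assume "i \<in> {0..j}"
    then show "fps_nth (F t) i * fps_nth ?G (j - i) = 0"
      using F[of i] G[of "j - i"] that by (cases "p < i") auto
  qed
  moreover have "fps_nth (F t * ?G) (p + size m * p) = fps_nth (F t) p * (\<Prod>t\<in>#m. fps_nth (F t) p)"
    if q: "p + size m * p < q"
  proof -
    have "fps_nth (F t * ?G) (p + size m * p)
        = fps_nth (F t) p * fps_nth ?G (p + size m * p - p)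
          + (\<Sum>i\<in>{0..p + size m * p} - {p}. fps_nth (F t) i * fps_nth ?G (p + size m * p - i))"
      unfolding fps_mult_nth by (intro sum.remove) auto
    also have "(\<Sum>i\<in>{0..p + size m * p} - {p}. fps_nth (F t) i * fps_nth ?G (p + size m * p - i)) = 0"
    proof (rule sum.neutral, rule ballI)
      fix i assume "i \<in> {0..p + size m * p} - {p}"
      then show "fps_nth (F t) i * fps_nth ?G (p + size m * p - i) = 0"
        using F[of i] G[of "p + size m * p - i"] q by (cases "p < i") auto
    qed
    finally show ?thesis using G0 q by simp
  qed
  ultimately show ?case by (simp add: split)
qed

text \<open>The factor \<open>k ^ (2 * p k)\<close> is squared because the analytic bound for the coefficients, with interval
  length \<open>1 / k\<close>, is itself of order \<open>k ^ n\<close>.\<close>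

definition gap_series :: "(nat \<Rightarrow> nat) \<Rightarrow> real \<Rightarrow> complex fps" where
  "gap_series p t = Abs_fps (\<lambda>j. if j \<in> range p
     then of_real (real (inv p j) ^ (2 * j) * exp (real (inv p j) powr t)) else 0)"

lemma gap_series_nth:
  assumes "strict_mono p"
  shows "fps_nth (gap_series p t) (p k) = of_real (real k ^ (2 * p k) * exp (real k powr t))"
  using strict_mono_imp_inj_on[OF assms] by (simp add: gap_series_def)

lemma gap_series_nth_between:
  assumes "strict_mono p" "p k < j" "j < p (Suc k)"
  shows "fps_nth (gap_series p t) j = 0"
proof -
  have "j \<notin> range p"
  proof
    assume "j \<in> range p"
    then obtain i where "j = p i" by blast
    then show False using assms by (simp add: strict_mono_less)
  qed
  then show ?thesis by (simp add: gap_series_def)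
qed

text \<open>A monomial of degree below \<open>d\<close> has its last term before the gap at an index
  smaller than \<open>d * p k\<close>. Hence only the top homogeneous part is seen at
  \<open>d * p k\<close>.\<close>

lemma gap_series_polynomial:
  fixes c :: "real multiset \<Rightarrow> complex"
  defines "P \<equiv> \<lambda>p A. \<Sum>m\<in>A. fps_const (c m) * fps_monomial (gap_series p) m"
  assumes p: "strict_mono p" and "finite A" and d: "\<forall>m\<in>A. size m \<le> d"
    and "0 < p k" and gap: "d * p k < p (Suc k)"
  shows "fps_nth (P p A) (d * p k) = of_real (real k ^ (2 * (d * p k)))
      * (\<Sum>m\<in>{m \<in> A. size m = d}. c m * of_real (exp (exponent_sum m (real k))))"
    and "\<And>j. d * p k < j \<Longrightarrow> j < p (Suc k) \<Longrightarrow> fps_nth (P p A) j = 0"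
proof -
  have mono: "(\<forall>j. size m * p k < j \<and> j < p (Suc k) \<longrightarrow> fps_nth (fps_monomial (gap_series p) m) j = 0)
    \<and> (size m * p k < p (Suc k) \<longrightarrow>
      fps_nth (fps_monomial (gap_series p) m) (size m * p k) = (\<Prod>t\<in>#m. fps_nth (gap_series p t) (p k)))" for m
    by (rule fps_monomial_gap) (rule gap_series_nth_between[OF p])
  have nth: "fps_nth (P p A) j = (\<Sum>m\<in>A. c m * fps_nth (fps_monomial (gap_series p) m) j)" for j
    by (simp add: P_def fps_sum_nth)
  have le: "size m * p k \<le> d * p k" if "m \<in> A" for m using d that by simp
  show "fps_nth (P p A) j = 0" if "d * p k < j" "j < p (Suc k)" for j
    unfolding nth
  proof (intro sum.neutral ballI)
    fix m assume "m \<in> A"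
    then have "size m * p k < j" using le[of m] that(1) by linarith
    then show "c m * fps_nth (fps_monomial (gap_series p) m) j = 0" using mono[of m] that by simp
  qed
  have top: "fps_nth (fps_monomial (gap_series p) m) (d * p k)
      = of_real (real k ^ (2 * (d * p k))) * of_real (exp (exponent_sum m (real k)))"
    if "size m = d" for m
  proof -
    have "fps_nth (fps_monomial (gap_series p) m) (d * p k) = (\<Prod>t\<in>#m. fps_nth (gap_series p t) (p k))"
      using mono[of m] that gap by simp
    also have "\<dots> = of_real ((real k ^ (2 * p k)) ^ size m * exp (exponent_sum m (real k)))"
      unfolding gap_series_nth[OF p] exponent_sum_def
      by (induction m) (simp_all add: exp_add)
    finally show ?thesis using that by (simp add: power_mult[symmetric] mult_ac)
  qed
  have "fps_nth (P p A) (d * p k)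
      = (\<Sum>m\<in>{m \<in> A. size m = d}. c m * fps_nth (fps_monomial (gap_series p) m) (d * p k))"
    unfolding nth
  proof (rule sum.mono_neutral_right)
    show "\<forall>m\<in>A - {m \<in> A. size m = d}. c m * fps_nth (fps_monomial (gap_series p) m) (d * p k) = 0"
    proof
      fix m assume "m \<in> A - {m \<in> A. size m = d}"
      then have "size m < d" using d by (auto simp: order_less_le)
      then show "c m * fps_nth (fps_monomial (gap_series p) m) (d * p k) = 0"
        using mono[of m] gap \<open>0 < p k\<close> by simp
    qed
  qed (use \<open>finite A\<close> in auto)
  also have "\<dots> = of_real (real k ^ (2 * (d * p k)))
      * (\<Sum>m\<in>{m \<in> A. size m = d}. c m * of_real (exp (exponent_sum m (real k))))"
    unfolding sum_distrib_left by (intro sum.cong refl) (simp add: top mult_ac)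
  finally show "fps_nth (P p A) (d * p k) = of_real (real k ^ (2 * (d * p k)))
      * (\<Sum>m\<in>{m \<in> A. size m = d}. c m * of_real (exp (exponent_sum m (real k))))" .
qed

text \<open>Here \<open>d\<close> is the total degree and \<open>B\<close> the top homogeneous part.
  At the arguments \<open>exp (k powr t)\<close> this part stays away from 0, so the common power of
  \<open>k\<close> determines the growth.\<close>

lemma gap_series_polynomial_growth:
  fixes c :: "real multiset \<Rightarrow> complex"
  defines "P \<equiv> \<lambda>p A. \<Sum>m\<in>A. fps_const (c m) * fps_monomial (gap_series p) m"
  assumes p: "strict_mono p" and gap: "\<forall>k. k * p k < p (Suc k)"
    and A: "finite A" "A \<noteq> {}"
    and m: "\<forall>m\<in>A. m \<noteq> {#} \<and> set_mset m \<subseteq> {0<..} \<and> c m \<noteq> 0"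
  obtains d \<epsilon> where "0 < d" "0 < \<epsilon>"
    "eventually (\<lambda>k. \<epsilon> * real k ^ (2 * (d * p k)) \<le> cmod (fps_nth (P p A) (d * p k)) \<and>
       (\<forall>j. d * p k < j \<and> j < p (Suc k) \<longrightarrow> fps_nth (P p A) j = 0)) sequentially"
proof -
  define d where "d = Max (size ` A)"
  define B where "B = {m \<in> A. size m = d}"
  have d: "\<forall>m\<in>A. size m \<le> d" using A by (simp add: d_def)
  have "d \<in> size ` A" unfolding d_def by (rule Max_in) (use A in auto)
  then obtain m1 where m1: "m1 \<in> A" "size m1 = d" by blast
  then have "0 < d" using m by (auto simp: nonempty_has_size)
  have "\<exists>\<epsilon>>0. eventually (\<lambda>s. \<epsilon> \<le> cmod (\<Sum>m\<in>B. c m * of_real (exp (exponent_sum m s)))) at_top"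
  proof (rule exponential_sum_bounded_below)
    show "finite B" "B \<noteq> {}" using A m1 by (auto simp: B_def)
    show "0 < t" if "m \<in> B" "t \<in># m" for m t using m that by (auto simp: B_def)
    show "c m \<noteq> 0" if "m \<in> B" for m using m that by (auto simp: B_def)
  qed
  then obtain \<epsilon> where \<epsilon>: "0 < \<epsilon>"
    "eventually (\<lambda>s. \<epsilon> \<le> cmod (\<Sum>m\<in>B. c m * of_real (exp (exponent_sum m s)))) at_top" by blast
  from \<epsilon>(2) have "eventually (\<lambda>k. \<epsilon> \<le> cmod (\<Sum>m\<in>B. c m * of_real (exp (exponent_sum m (real k))))) sequentially"
    by (rule eventually_compose_filterlim[OF _ filterlim_real_sequentially])
  \<comment> \<open>The condition \<open>d \<le> k\<close> turns the gap after
    \<open>k * p k\<close> into one after \<open>d * p k\<close>; \<open>1 \<le> k\<close> ensures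
    that \<open>p k\<close> is positive.\<close>
  moreover have "eventually (\<lambda>k. max 1 d \<le> k) sequentially" by (rule eventually_ge_at_top)
  ultimately have "eventually (\<lambda>k. \<epsilon> * real k ^ (2 * (d * p k)) \<le> cmod (fps_nth (P p A) (d * p k)) \<and>
       (\<forall>j. d * p k < j \<and> j < p (Suc k) \<longrightarrow> fps_nth (P p A) j = 0)) sequentially"
  proof eventually_elim
    case (elim k)
    have "k \<le> p k" using p by (rule strict_mono_imp_increasing)
    then have "0 < p k" using elim by simp
    have "d * p k \<le> k * p k" using elim by (intro mult_right_mono) auto
    then have dk: "d * p k < p (Suc k)" using spec[OF gap, of k] by linarith
    note poly = gap_series_polynomial[of p A d k, OF p A(1) d \<open>0 < p k\<close> dk]
    show ?case
    proof (intro conjI allI impI)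
      have "cmod (fps_nth (P p A) (d * p k))
          = real k ^ (2 * (d * p k)) * cmod (\<Sum>m\<in>B. c m * of_real (exp (exponent_sum m (real k))))"
        unfolding P_def poly(1) B_def by (simp add: norm_mult norm_power)
      then show "\<epsilon> * real k ^ (2 * (d * p k)) \<le> cmod (fps_nth (P p A) (d * p k))"
        using elim by (simp add: mult.commute mult_left_mono)
    qed (use poly(2) in \<open>auto simp: P_def\<close>)
  qed
  with \<open>0 < d\<close> \<open>0 < \<epsilon>\<close> show thesis by (rule that)
qed

section \<open>The Borel image and the choice of the gaps\<close>

definition gap_series_avoids :: "(nat \<Rightarrow> nat) \<Rightarrow> complex fps set \<Rightarrow> bool" where
  "gap_series_avoids p X \<longleftrightarrow> (\<forall>A c. finite A \<longrightarrow> A \<noteq> {} \<longrightarrow>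
     (\<forall>m\<in>A. m \<noteq> {#} \<and> set_mset m \<subseteq> {0<..} \<and> c m \<noteq> 0) \<longrightarrow>
     (\<Sum>m\<in>A. fps_const (c m) * fps_monomial (gap_series p) m) \<notin> X)"

text \<open>Turns membership in the Borel image into data of the kind that \<open>bang_gap\<close>
  handles: a sequence of successive derivatives on \<open>[0, \<delta>]\<close> with bounds by one
  weight.\<close>

lemma borel_map_E0_Roumieu_derivatives:
  assumes "weight_matrix \<M>" "F \<in> borel_map ` E0_Roumieu \<M>"
  obtains \<delta> h \<alpha> :: real and f :: "nat \<Rightarrow> real \<Rightarrow> complex" and C :: real
  where "0 < \<delta>" "0 < h" "0 < \<alpha>" "\<And>j. f j 0 = fact j * fps_nth F j"
    "\<And>j x. 0 \<le> x \<Longrightarrow> x \<le> \<delta> \<Longrightarrow> (f j has_vector_derivative f (Suc j) x) (at x)"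
    "\<And>j x. 0 \<le> x \<Longrightarrow> x \<le> \<delta> \<Longrightarrow> cmod (f j x) \<le> C * (h ^ j * \<M> \<alpha> j)"
proof -
  obtain k f where k: "1 \<le> k" and f: "f \<in> E_Roumieu \<M> {- 1 / real k <..< 1 / real k}"
    and F: "F = borel_map (germ0_of f)"
    using assms(2) by (auto simp: E0_Roumieu_def)
  define \<delta> where "\<delta> = 1 / (2 * real k)"
  have \<delta>: "0 < \<delta>" "\<delta> < 1 / real k" using k by (auto simp: \<delta>_def field_simps)
  have sub: "{0..\<delta>} \<subseteq> {- 1 / real k <..< 1 / real k}"
  proof
    fix x assume "x \<in> {0..\<delta>}"
    moreover have "- 1 / real k < 0" using k by simp
    ultimately show "x \<in> {- 1 / real k <..< 1 / real k}"
      using \<delta> by (simp only: atLeastAtMost_iff greaterThanLessThan_iff) linarith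
  qed
  obtain \<alpha> h where \<alpha>: "0 < \<alpha>" "0 < h" and "ultra_bounded (\<M> \<alpha>) h {0..\<delta>} f"
    using f sub compact_Icc unfolding E_Roumieu_def by blast
  then obtain C where "\<forall>y\<in>(\<lambda>(j, x). cmod (nderiv j f x) / (h ^ j * \<M> \<alpha> j)) ` (UNIV \<times> {0..\<delta>}). y \<le> C"
    unfolding ultra_bounded_def bdd_above_def by blast
  then have C: "cmod (nderiv j f x) / (h ^ j * \<M> \<alpha> j) \<le> C" if "x \<in> {0..\<delta>}" for j x
    using that by force
  show thesis
  proof (rule that[of \<delta> h \<alpha> "\<lambda>j. nderiv j f" C])
    show "nderiv j f 0 = fact j * fps_nth F j" for j
      unfolding F borel_map.abs_eq by simp
    show "(nderiv j f has_vector_derivative nderiv (Suc j) f x) (at x)" if "0 \<le> x" "x \<le> \<delta>" for j x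
    proof -
      have "nderiv j f differentiable (at x)"
        using f sub that by (auto simp: E_Roumieu_def smooth_on_def)
      then show ?thesis by (simp add: vector_derivative_works nderiv_def)
    qed
    show "cmod (nderiv j f x) \<le> C * (h ^ j * \<M> \<alpha> j)" if "0 \<le> x" "x \<le> \<delta>" for j x
    proof -
      have "0 < h ^ j * \<M> \<alpha> j" using \<alpha> weight_matrixD(2)[OF assms(1)] by simp
      then show ?thesis using C[of x j] that by (simp add: pos_divide_le_eq)
    qed
  qed (use \<delta> \<alpha> in auto)
qed

lemma E0_Beurling_subset_Roumieu: "E0_Beurling \<M> \<subseteq> E0_Roumieu \<M>"
proof -
  have "E_Beurling \<M> U \<subseteq> E_Roumieu \<M> U" for U
    unfolding E_Beurling_def E_Roumieu_def using zero_less_one by blast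
  then show ?thesis unfolding E0_Beurling_def E0_Roumieu_def by blast
qed

text \<open>Because of this, a polynomial value outside the Borel image is nonzero, so avoiding the
  image already implies algebraic independence.\<close>

lemma zero_in_borel_map_E0_Beurling: "0 \<in> borel_map ` E0_Beurling \<M>"
proof -
  have n: "nderiv j (\<lambda>x. 0) = (\<lambda>x. 0)" for j
    by (induction j) (auto simp: nderiv_def)
  have "ultra_bounded M h K (\<lambda>x. 0)" for M h K
    unfolding ultra_bounded_def n by (rule bdd_aboveI[of _ 0]) auto
  then have "(\<lambda>x. 0) \<in> E_Beurling \<M> {- 1 / real 1 <..< 1 / real 1}"
    by (simp add: E_Beurling_def smooth_on_def n)
  then have "germ0_of (\<lambda>x. 0) \<in> E0_Beurling \<M>" unfolding E0_Beurling_def by blast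
  moreover have "borel_map (germ0_of (\<lambda>x. 0)) = 0"
    unfolding borel_map.abs_eq by (simp add: n fps_eq_iff)
  ultimately show ?thesis by (metis image_eqI)
qed

text \<open>The parameters \<open>\<alpha>\<close>, \<open>h\<close>, \<open>C\<close> and
  \<open>1 / \<delta>\<close> of any single function are at most \<open>k\<close> for all large
  \<open>k\<close>, so one condition for each \<open>k\<close> covers all functions. The predicate
  \<open>good\<close> leaves room for lower bounds on the other matrix at the indices
  \<open>p k\<close>; it only has to hold for arbitrarily large indices.\<close>

lemma gap_sequence_exists:
  assumes \<M>: "weight_matrix \<M>" "quasianalytic_matrix \<M>"
    and good: "\<And>k b. \<exists>p\<ge>b. good k p"
  shows "\<exists>p. strict_mono p \<and> (\<forall>k. good k (p k)) \<and> gap_series_avoids p (borel_map ` E0_Roumieu \<M>)"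
proof -
  \<comment> \<open>The conclusion of \<open>bang_gap\<close> for a gap from \<open>n\<close> to
    \<open>q\<close>, with constant \<open>k\<close>, interval length \<open>1 / k\<close> and
    weight \<open>k ^ j * \<M> k j\<close>.\<close>
  define R where "R = (\<lambda>k n q. \<forall>f :: nat \<Rightarrow> real \<Rightarrow> complex.
    (\<forall>j x. 0 \<le> x \<and> x \<le> 1 / real k \<longrightarrow>
      (f j has_vector_derivative f (Suc j) x) (at x) \<and> cmod (f j x) \<le> real k * (real k ^ j * \<M> k j)) \<longrightarrow>
    (\<forall>j. n < j \<and> j < q \<longrightarrow> f j 0 = 0) \<longrightarrow>
    cmod (f n 0) / fact n \<le> (real k + 1) * (2 * exp 1 / (1 / real k)) ^ n)"
  have "\<exists>Q. 1 \<le> k \<longrightarrow> (\<forall>q\<ge>Q. R k n q)" for k n :: nat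
  proof (cases "1 \<le> k")
    case True
    then have k: "0 < real k" by simp
    have W: "weight_sequence (\<M> k)" using \<M> k by (simp add: weight_matrix_def)
    have Q: "quasianalytic (\<M> k)" using \<M> k by (simp add: quasianalytic_matrix_def)
    have "1 \<le> real k ^ j * \<M> k j" for j
      using True weight_sequence_ge_1[OF W, of j] mult_mono[of 1 "real k ^ j" 1 "\<M> k j"] by simp
    moreover have "filterlim (\<lambda>n. \<Sum>j=1..n. real k ^ (j - 1) * \<M> k (j - 1) / (real k ^ j * \<M> k j)) at_top sequentially"
      using quasianalytic_geometric[OF Q k] by (simp add: quasianalytic_def)
    moreover have "real k ^ 0 * \<M> k 0 = 1" using W by (simp add: weight_sequence_def)
    ultimately have "\<exists>Q. \<forall>q\<ge>Q. R k n q"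
      unfolding R_def using k True
      by (intro bang_gap log_convex_geometric weight_sequence_log_convex W) auto
    then show ?thesis by blast
  qed simp
  then obtain Q where Q: "\<And>k n q. 1 \<le> k \<Longrightarrow> Q k n \<le> q \<Longrightarrow> R k n q"
    by metis
  \<comment> \<open>The sum over \<open>d \<le> k\<close> makes the next gap long enough for all
    degrees up to \<open>k\<close> at once. The other two summands give strict monotonicity and the
    gap after \<open>k * p k\<close>.\<close>
  have "\<exists>p. \<forall>k. good k (p k) \<and> p k + k * p k + (\<Sum>d\<le>k. Q k (d * p k)) < p (Suc k)"
  proof (rule dependent_nat_choice)
    show "\<exists>x. good 0 x" using good by blast
    show "\<exists>y. good (Suc k) y \<and> x + k * x + (\<Sum>d\<le>k. Q k (d * x)) < y" for x k
      using good[where k = "Suc k" and b = "Suc (x + k * x + (\<Sum>d\<le>k. Q k (d * x)))"] by (auto simp: Suc_le_eq)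
  qed
  then obtain p where p: "\<And>k. good k (p k)" "\<And>k. p k + k * p k + (\<Sum>d\<le>k. Q k (d * p k)) < p (Suc k)"
    by blast
  have mono: "strict_mono p"
    unfolding strict_mono_Suc_iff using p(2) by (meson add_lessD1)
  have gap: "\<forall>k. k * p k < p (Suc k)"
  proof
    show "k * p k < p (Suc k)" for k using p(2)[of k] by linarith
  qed
  have Qp: "Q k (d * p k) \<le> p (Suc k)" if "d \<le> k" for d k
    using p(2)[of k] member_le_sum[of d "{..k}" "\<lambda>d. Q k (d * p k)"] that by simp
  have "gap_series_avoids p (borel_map ` E0_Roumieu \<M>)"
    unfolding gap_series_avoids_def
  proof (intro allI impI)
    fix A and c :: "real multiset \<Rightarrow> complex"
    assume A: "finite A" "A \<noteq> {}" "\<forall>m\<in>A. m \<noteq> {#} \<and> set_mset m \<subseteq> {0<..} \<and> c m \<noteq> 0"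
    define P where "P = (\<Sum>m\<in>A. fps_const (c m) * fps_monomial (gap_series p) m)"
    obtain d \<epsilon> where d: "0 < d" and \<epsilon>: "0 < \<epsilon>"
      and grow: "eventually (\<lambda>k. \<epsilon> * real k ^ (2 * (d * p k)) \<le> cmod (fps_nth P (d * p k)) \<and>
       (\<forall>j. d * p k < j \<and> j < p (Suc k) \<longrightarrow> fps_nth P j = 0)) sequentially"
      unfolding P_def by (rule gap_series_polynomial_growth[OF mono gap A])
    show "(\<Sum>m\<in>A. fps_const (c m) * fps_monomial (gap_series p) m) \<notin> borel_map ` E0_Roumieu \<M>"
      unfolding P_def[symmetric]
    proof
      assume "P \<in> borel_map ` E0_Roumieu \<M>"
      then obtain \<delta> h \<alpha> :: real and f :: "nat \<Rightarrow> real \<Rightarrow> complex" and C :: real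
        where pos: "0 < \<delta>" "0 < h" "0 < \<alpha>" and f0: "\<And>j. f j 0 = fact j * fps_nth P j"
          and der: "\<And>j x. 0 \<le> x \<Longrightarrow> x \<le> \<delta> \<Longrightarrow> (f j has_vector_derivative f (Suc j) x) (at x)"
          and bound: "\<And>j x. 0 \<le> x \<Longrightarrow> x \<le> \<delta> \<Longrightarrow> cmod (f j x) \<le> C * (h ^ j * \<M> \<alpha> j)"
        by (rule borel_map_E0_Roumieu_derivatives[OF \<M>(1)]) (rule that)
      \<comment> \<open>Beyond \<open>X\<close>, the number \<open>k\<close> dominates all constants
        of \<open>f\<close>, is at least the degree \<open>d\<close>, and is at least
        \<open>8 * exp 1\<close>, that is, 4 times the base \<open>2 * exp 1\<close> left after
        cancelling \<open>k ^ n\<close>; the bound \<open>1 / \<epsilon>\<close> serves the final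
        contradiction.\<close>
      define X where "X = max 1 (max (1 / \<delta>) (max C (max h (max \<alpha> (max (8 * exp 1) (max (1 / \<epsilon>) (real d)))))))"
      have "eventually (\<lambda>k. X \<le> real k) sequentially"
        using filterlim_real_sequentially by (simp add: filterlim_at_top)
      from eventually_happens'[OF sequentially_bot eventually_conj[OF this grow]]
      obtain k where Xk: "X \<le> real k"
        and big: "\<epsilon> * real k ^ (2 * (d * p k)) \<le> cmod (fps_nth P (d * p k))"
        and zero: "\<And>j. d * p k < j \<Longrightarrow> j < p (Suc k) \<Longrightarrow> fps_nth P j = 0"
        by blast
      have k: "1 \<le> real k" "1 / \<delta> \<le> real k" "C \<le> real k" "h \<le> real k" "\<alpha> \<le> real k"
        "8 * exp 1 \<le> real k" "1 / \<epsilon> \<le> real k" "d \<le> k"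
        using Xk unfolding X_def max.bounded_iff of_nat_le_iff by blast+
      define n where "n = d * p k"
      have "1 / real k \<le> \<delta>" using k pos by (simp add: field_simps)
      have "R k n (p (Suc k))" using Qp k by (intro Q) (auto simp: n_def)
      moreover have "(f j has_vector_derivative f (Suc j) x) (at x) \<and> cmod (f j x) \<le> real k * (real k ^ j * \<M> k j)"
        if x: "0 \<le> x" "x \<le> 1 / real k" for j x
      proof -
        have "C * (h ^ j * \<M> \<alpha> j) \<le> real k * (real k ^ j * \<M> k j)"
          using k pos weight_matrixD(2,3)[OF \<M>(1), of \<alpha>]
          by (intro mult_mono power_mono) (auto simp: less_imp_le)
        then show ?thesis
          using der[of x j] bound[of x j] x \<open>1 / real k \<le> \<delta>\<close> by auto
      qed
      moreover have "f j 0 = 0" if "n < j" "j < p (Suc k)" for j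
        using zero[of j] that by (simp add: n_def f0)
      ultimately have "cmod (f n 0) / fact n \<le> (real k + 1) * (2 * exp 1 / (1 / real k)) ^ n"
        unfolding R_def by blast
      then have "cmod (fps_nth P n) \<le> (real k + 1) * (2 * exp 1 * real k) ^ n"
        by (simp add: f0 norm_mult)
      with big have "\<epsilon> * real k ^ (2 * n) \<le> (real k + 1) * (2 * exp 1 * real k) ^ n"
        by (simp add: n_def)
      moreover have "real k ^ (2 * n) = real k ^ n * real k ^ n" by (simp only: mult_2 power_add)
      ultimately have "(\<epsilon> * real k ^ n) * real k ^ n \<le> ((real k + 1) * (2 * exp 1) ^ n) * real k ^ n"
        by (simp only: power_mult_distrib mult.assoc mult.commute mult.left_commute)
      then have kn: "\<epsilon> * real k ^ n \<le> (real k + 1) * (2 * exp 1) ^ n"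
        using k by (simp add: mult_le_cancel_right)
      have "(\<epsilon> * 4 ^ n) * (2 * exp 1) ^ n = \<epsilon> * (4 * (2 * exp 1)) ^ n"
        by (simp only: power_mult_distrib mult.assoc)
      also have "\<dots> \<le> \<epsilon> * real k ^ n"
        using k \<epsilon> by (intro mult_left_mono power_mono) auto
      also note kn
      finally have "(\<epsilon> * 4 ^ n) * (2 * exp 1) ^ n \<le> (real k + 1) * (2 * exp 1) ^ n" .
      then have "\<epsilon> * 4 ^ n \<le> real k + 1"
        by (rule mult_right_le_imp_le) simp
      \<comment> \<open>From here only \<open>\<epsilon> * 4 ^ k \<le> k + 1 \<le> 2 ^ k\<close>
        matters. It gives \<open>\<epsilon> * (k + 1) \<le> \<epsilon> * 2 ^ k \<le> 1\<close>,
        against \<open>1 \<le> \<epsilon> * k\<close>.\<close>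
      moreover have "k \<le> n"
        using mult_le_mono[OF Suc_leI[OF d] strict_mono_imp_increasing[OF mono, of k]] by (simp add: n_def)
      then have "\<epsilon> * 4 ^ k \<le> \<epsilon> * 4 ^ n" using \<epsilon> by (intro mult_left_mono power_increasing) auto
      moreover have "real k + 1 \<le> 2 ^ k"
        using less_exp[of k] by (metis Suc_leI of_nat_Suc of_nat_le_iff of_nat_numeral of_nat_power add.commute)
      moreover have "(4 :: real) ^ k = 2 ^ k * 2 ^ k" by (simp flip: power_mult_distrib)
      ultimately have "(\<epsilon> * 2 ^ k) * 2 ^ k \<le> 1 * 2 ^ k"
        unfolding mult.assoc mult_1 by (metis order_trans)
      then have "\<epsilon> * 2 ^ k \<le> 1" by (rule mult_right_le_imp_le) simp
      moreover have "\<epsilon> * (real k + 1) \<le> \<epsilon> * 2 ^ k"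
        using \<epsilon> \<open>real k + 1 \<le> 2 ^ k\<close> by (intro mult_left_mono) auto
      moreover have "1 \<le> \<epsilon> * real k" using k \<epsilon> by (simp add: field_simps)
      ultimately show False using \<epsilon> by (simp add: distrib_left)
    qed
  qed
  with mono p(1) show ?thesis by blast
qed

section \<open>Membership of the gap series in the weighted spaces\<close>

text \<open>As \<open>t \<le> 1\<close> and \<open>k \<le> p k\<close>, the factor
  \<open>exp (k powr t)\<close> is at most \<open>exp 1 ^ p k\<close>, so the coefficient is at most
  \<open>(exp 1 * k\<^sup>2) ^ p k\<close>. The finitely many \<open>k\<close> below
  \<open>k0\<close> do not affect boundedness.\<close>

lemma fps_bounded_gap_series:
  assumes N: "\<And>j. 0 < N j" and "0 < h" and p: "strict_mono p" and "t \<le> 1" and "1 \<le> k0"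
    and le: "\<And>k. k0 \<le> k \<Longrightarrow> (exp 1 * (real k)\<^sup>2) ^ p k \<le> h ^ p k * div_fact N (p k)"
  shows "fps_bounded N h (gap_series p t)"
proof -
  let ?u = "\<lambda>j. cmod (fps_nth (gap_series p t) j) / (h ^ j * div_fact N j)"
  have pos: "0 < h ^ j * div_fact N j" for j using N \<open>0 < h\<close> by (simp add: div_fact_def)
  have small: "?u j \<le> 1" if "j \<notin> p ` {..<k0}" for j
  proof (cases "j \<in> range p")
    case True
    then obtain k where k: "j = p k" by blast
    then have "k0 \<le> k" using that by (meson image_eqI lessThan_iff not_le)
    then have "1 \<le> real k" using \<open>1 \<le> k0\<close> by simp
    then have "real k powr t \<le> real k powr 1" using \<open>t \<le> 1\<close> by (intro powr_mono)
    also have "\<dots> \<le> real (p k)" using strict_mono_imp_increasing[OF p, of k] \<open>1 \<le> real k\<close> by simp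
    finally have "exp (real k powr t) \<le> exp 1 ^ p k"
      by (simp flip: exp_of_nat_mult)
    then have "cmod (fps_nth (gap_series p t) j) \<le> real k ^ (2 * p k) * exp 1 ^ p k"
      unfolding k gap_series_nth[OF p] by (simp add: norm_mult norm_power mult_left_mono)
    also have "\<dots> \<le> h ^ j * div_fact N j"
      using le[OF \<open>k0 \<le> k\<close>] by (simp add: k power_mult_distrib mult.commute flip: power_mult)
    finally show ?thesis using pos[of j] by simp
  next
    case False
    then show ?thesis by (simp add: gap_series_def)
  qed
  have "range ?u \<subseteq> ?u ` p ` {..<k0} \<union> {..1}" using small by blast
  then show ?thesis
    unfolding fps_bounded_def by (rule bdd_above_mono[rotated]) simp
qed

text \<open>Finitely many real values have a finite maximum, so an infinite supremum is still
  approached beyond every index.\<close>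

lemma Sup_ereal_infinity_frequently:
  fixes u :: "nat \<Rightarrow> real"
  assumes "(SUP j\<in>{1..}. ereal (u j)) = \<infinity>"
  shows "\<exists>j\<ge>b. x \<le> u j"
proof (rule ccontr)
  assume "\<not> (\<exists>j\<ge>b. x \<le> u j)"
  then have x: "u j \<le> x" if "b \<le> j" for j using that by force
  define y where "y = max x (Max (insert 0 (u ` {..<b})))"
  have "u j \<le> y" for j
  proof (cases "b \<le> j")
    case False
    then have "u j \<le> Max (insert 0 (u ` {..<b}))" by (intro Max_ge) auto
    then show ?thesis by (simp add: y_def)
  qed (use x in \<open>simp add: y_def le_max_iff_disj\<close>)
  then have "(SUP j\<in>{1..}. ereal (u j)) \<le> ereal y" by (intro SUP_least) simp
  then show False using assms by simp
qed

theorem theorem3p8: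
  fixes \<M> \<N> :: "real \<Rightarrow> nat \<Rightarrow> real"
  assumes "weight_matrix \<M>" and "quasianalytic_matrix \<M>"
    and "weight_matrix \<N>" and "quasianalytic_matrix \<N>"
  shows
    "((\<forall>\<alpha>>0. filterlim (\<lambda>j. root j (div_fact (\<N> \<alpha>) j)) at_top sequentially) \<longrightarrow>
        continuum_algebrable_in (F_Beurling \<N>) (F_Beurling \<N> - borel_map ` E0_Roumieu \<M>) \<and>
        continuum_algebrable_in (F_Beurling \<N>) (F_Beurling \<N> - borel_map ` E0_Beurling \<M>)) \<and>
     ((\<forall>\<alpha>>0. (SUP j\<in>{1..}. ereal (root j (div_fact (\<N> \<alpha>) j))) = \<infinity>) \<longrightarrow>
        continuum_algebrable_in (F_Roumieu \<N>) (F_Roumieu \<N> - borel_map ` E0_Roumieu \<M>) \<and>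
        continuum_algebrable_in (F_Roumieu \<N>) (F_Roumieu \<N> - borel_map ` E0_Beurling \<M>))"
proof -
  have I: "{0<..<1 :: real} \<approx> (UNIV :: real set)" by (simp add: open_interval_eqpoll_reals)
  have N: "0 < \<N> \<alpha> j" if "0 < \<alpha>" for \<alpha> j using weight_matrixD(2)[OF assms(3) that] .
  have root_le: "x ^ j \<le> div_fact (\<N> \<alpha>) j"
    if "0 < \<alpha>" "1 \<le> j" "0 \<le> x" "x \<le> root j (div_fact (\<N> \<alpha>) j)" for x \<alpha> j
  proof -
    have "x ^ j \<le> root j (div_fact (\<N> \<alpha>) j) ^ j" using that by (intro power_mono)
    also have "\<dots> = div_fact (\<N> \<alpha>) j"
      using that N[OF that(1), of j] by (intro real_root_pow_pos2) (auto simp: div_fact_def)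
    finally show ?thesis .
  qed
  \<comment> \<open>The part common to both cases. The Beurling image lies in the Roumieu image, so
    avoiding the latter serves for both complements.\<close>
  have conclude: "continuum_algebrable_in \<A> (\<A> - borel_map ` E0_Roumieu \<M>) \<and>
      continuum_algebrable_in \<A> (\<A> - borel_map ` E0_Beurling \<M>)"
    if \<A>: "subalgebra (\<lambda>c F. fps_const c * F) \<A>" "\<And>t. t \<in> {0<..<1} \<Longrightarrow> gap_series p t \<in> \<A>"
      and avoid: "gap_series_avoids p (borel_map ` E0_Roumieu \<M>)"
    for \<A> p
  proof -
    have "(\<Sum>m\<in>A. fps_const (c m) * fps_monomial (gap_series p) m) \<notin> insert 0 (borel_map ` E0_Roumieu \<M>)"
      if "finite A" "A \<noteq> {}" "\<And>m. m \<in> A \<Longrightarrow> m \<noteq> {#} \<and> set_mset m \<subseteq> {0<..<1} \<and> c m \<noteq> 0" for A c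
    proof -
      have "0 \<in> borel_map ` E0_Roumieu \<M>"
        using zero_in_borel_map_E0_Beurling E0_Beurling_subset_Roumieu by blast
      moreover have "\<forall>m\<in>A. m \<noteq> {#} \<and> set_mset m \<subseteq> {0<..} \<and> c m \<noteq> 0"
        using that(3) by fastforce
      then have "(\<Sum>m\<in>A. fps_const (c m) * fps_monomial (gap_series p) m) \<notin> borel_map ` E0_Roumieu \<M>"
        using avoid that(1,2) unfolding gap_series_avoids_def by blast
      ultimately show ?thesis by (metis insertE)
    qed
    then have *: "(\<Sum>m\<in>A. fps_const (c m) * fps_monomial (gap_series p) m) \<notin> insert 0 X"
      if "finite A" "A \<noteq> {}" "\<And>m. m \<in> A \<Longrightarrow> m \<noteq> {#} \<and> set_mset m \<subseteq> {0<..<1} \<and> c m \<noteq> 0"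
        "X \<subseteq> borel_map ` E0_Roumieu \<M>" for A c X
      using that(4) insert_mono[OF that(4)] that(1-3) by (meson subsetD)
    have "continuum_algebrable_in \<A> (\<A> - X)" if "X \<subseteq> borel_map ` E0_Roumieu \<M>" for X
    proof (rule continuum_algebrable_inI[OF \<A> I])
      fix A and c :: "real multiset \<Rightarrow> complex"
      assume "finite A" "A \<noteq> {}" "\<And>m. m \<in> A \<Longrightarrow> m \<noteq> {#} \<and> set_mset m \<subseteq> {0<..<1} \<and> c m \<noteq> 0"
      then show "(\<Sum>m\<in>A. fps_const (c m) * fps_monomial (gap_series p) m) \<notin> insert 0 X"
        using that by (rule *)
    qed
    then show ?thesis using E0_Beurling_subset_Roumieu by blast
  qed
  show ?thesis
  proof (intro conjI[OF impI impI])
    assume lim: "\<forall>\<alpha>>0. filterlim (\<lambda>j. root j (div_fact (\<N> \<alpha>) j)) at_top sequentially"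
    \<comment> \<open>The coefficients need \<open>(exp 1 * k\<^sup>2) ^ p k\<close>; the third
      power of \<open>k\<close> leaves a spare factor \<open>k\<close> that beats
      \<open>exp 1 / h\<close> for every \<open>h\<close>, and the index \<open>1 / k\<close> falls
      below every \<open>\<alpha>\<close>. The guard excludes \<open>k = 0\<close>, where
      \<open>1 / k\<close> is 0 and no valid index.\<close>
    define good where "good = (\<lambda>k j. 1 \<le> k \<longrightarrow> (real k ^ 3) ^ j \<le> div_fact (\<N> (1 / real k)) j)"
    have "\<exists>j\<ge>b. good k j" for k b
    proof (cases "1 \<le> k")
      case True
      then have "eventually (\<lambda>j. real k ^ 3 \<le> root j (div_fact (\<N> (1 / real k)) j)) sequentially"
        using lim by (simp add: filterlim_at_top)
      from eventually_happens'[OF sequentially_bot eventually_conj[OF this eventually_ge_at_top[of "max 1 b"]]]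
      obtain j where "real k ^ 3 \<le> root j (div_fact (\<N> (1 / real k)) j)" "max 1 b \<le> j" by blast
      then show ?thesis using True root_le[of "1 / real k" j "real k ^ 3"] by (auto simp: good_def)
    qed (auto simp: good_def)
    from gap_sequence_exists[where good = good, OF assms(1,2) this] obtain p where p: "strict_mono p" "\<And>k. good k (p k)"
      and avoid: "gap_series_avoids p (borel_map ` E0_Roumieu \<M>)"
      by blast
    show "continuum_algebrable_in (F_Beurling \<N>) (F_Beurling \<N> - borel_map ` E0_Roumieu \<M>) \<and>
        continuum_algebrable_in (F_Beurling \<N>) (F_Beurling \<N> - borel_map ` E0_Beurling \<M>)"
    proof (rule conclude[OF subalgebra_F_Beurling[OF assms(3)] _ avoid])
      fix t :: real assume t: "t \<in> {0<..<1}"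
      have "fps_bounded (\<N> \<alpha>) h (gap_series p t)" if pos: "0 < \<alpha>" "0 < h" for \<alpha> h
      proof (rule fps_bounded_gap_series)
        define k0 where "k0 = nat \<lceil>max 1 (max (1 / \<alpha>) (exp 1 / h))\<rceil>"
        have k0: "max 1 (max (1 / \<alpha>) (exp 1 / h)) \<le> real k0" unfolding k0_def by (rule real_nat_ceiling_ge)
        then show "1 \<le> k0" by simp
        fix k assume "k0 \<le> k"
        then have k: "1 \<le> real k" "1 / \<alpha> \<le> real k" "exp 1 / h \<le> real k" using k0 by auto
        have "exp 1 * (real k)\<^sup>2 \<le> h * real k ^ 3"
          using k(1,3) pos by (simp add: field_simps power2_eq_square power3_eq_cube)
        then have "(exp 1 * (real k)\<^sup>2) ^ p k \<le> h ^ p k * (real k ^ 3) ^ p k"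
          unfolding power_mult_distrib[symmetric] by (intro power_mono) auto
        also have "\<dots> \<le> h ^ p k * div_fact (\<N> (1 / real k)) (p k)"
          using p(2)[of k] k pos by (auto simp: good_def)
        also have "\<dots> \<le> h ^ p k * div_fact (\<N> \<alpha>) (p k)"
          using weight_matrixD(3)[OF assms(3), of "1 / real k" \<alpha> "p k"] k pos
          by (auto simp: div_fact_def field_simps divide_right_mono intro!: mult_left_mono)
        finally show "(exp 1 * (real k)\<^sup>2) ^ p k \<le> h ^ p k * div_fact (\<N> \<alpha>) (p k)" .
      qed (use t p pos N in auto)
      then show "gap_series p t \<in> F_Beurling \<N>" by (simp add: F_Beurling_def)
    qed
  next
    assume "\<forall>\<alpha>>0. (SUP j\<in>{1..}. ereal (root j (div_fact (\<N> \<alpha>) j))) = \<infinity>"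
    then have sup: "(SUP j\<in>{1..}. ereal (root j (div_fact (\<N> 1) j))) = \<infinity>" by simp
    \<comment> \<open>In the Roumieu case one index and one \<open>h\<close> suffice: the index 1 is
      fixed, and \<open>h = exp 1\<close> will absorb \<open>exp 1 ^ p k\<close>, so the second
      power of \<open>k\<close> is enough.\<close>
    have "\<exists>j\<ge>b. ((real k)\<^sup>2) ^ j \<le> div_fact (\<N> 1) j" for k b
    proof -
      obtain j where "max 1 b \<le> j" "(real k)\<^sup>2 \<le> root j (div_fact (\<N> 1) j)"
        using Sup_ereal_infinity_frequently[OF sup] by blast
      then show ?thesis using root_le[of 1 j "(real k)\<^sup>2"] by auto
    qed
    from gap_sequence_exists[where good = "\<lambda>k j. ((real k)\<^sup>2) ^ j \<le> div_fact (\<N> 1) j", OF assms(1,2) this] obtain p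
      where p: "strict_mono p" "\<And>k. ((real k)\<^sup>2) ^ p k \<le> div_fact (\<N> 1) (p k)"
      and avoid: "gap_series_avoids p (borel_map ` E0_Roumieu \<M>)"
      by blast
    show "continuum_algebrable_in (F_Roumieu \<N>) (F_Roumieu \<N> - borel_map ` E0_Roumieu \<M>) \<and>
        continuum_algebrable_in (F_Roumieu \<N>) (F_Roumieu \<N> - borel_map ` E0_Beurling \<M>)"
    proof (rule conclude[OF subalgebra_F_Roumieu[OF assms(3)] _ avoid])
      fix t :: real assume t: "t \<in> {0<..<1}"
      have "fps_bounded (\<N> 1) (exp 1) (gap_series p t)"
      proof (rule fps_bounded_gap_series)
        show "(exp 1 * (real k)\<^sup>2) ^ p k \<le> exp 1 ^ p k * div_fact (\<N> 1) (p k)" for k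
          unfolding power_mult_distrib using p(2) by (intro mult_left_mono) auto
      qed (use t p N in auto)
      then show "gap_series p t \<in> F_Roumieu \<N>"
        unfolding F_Roumieu_def using zero_less_one exp_gt_zero by blast
    qed
  qed
qed

end
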